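(* Let $G$ be a group and let $A\subseteq G$ be a subset of minimal type. Let $Z_1$ and $Z_2$ be universal minimal $G$-spaces of type $A$. Then $Z_1$ and $Z_2$ are isomorphic as $G$-spaces (i.e., there is a $G$-equivariant homeomorphism $Z_1\to Z_2$).
   Context: $G$ is a discrete group. A locally compact $G$-space is a locally compact Hausdorff space with an action of $G$ by homeomorphisms. It is minimal if it is non-empty and every orbit is dense; it is co-compact if there is a compact $K\subseteq X$ with $\bigcup_{g\in G}g.K=X$ (minimal locally compact $G$-spaces are co-compact). A $G$-map is a $G$-equivariant map; a continuous map is proper if preimages of compact sets are compact. A pointed locally compact $G$-space is a pair $(X,x_0)$ with $x_0\in X$ such that $G.x_0$ is dense in $X$. For non-empty $A,B\subseteq G$ write $A\propto B$ if $A\subseteq FB=\bigcup_{g\in F}gB$ for some finite $F\subseteq G$, and $A\approx B$ if $A\propto B$ and $B\propto A$; $[A]$ is the $\approx$-class of $A$. Type: for a pointed locally compact $G$-space $(X,x_0)$ put $\mathcal M(G,X,x_0)=\{B\subseteq G:\overline{B.x_0}\text{ is compact}\}$, and $\mathcal M_A=\{B\subseteq G: B\subseteq FA\text{ for some finite }F\subseteq G\}$. If $X$ is co-compact, there is a non-empty $A\subseteq G$, unique up to $\approx$, with $\mathcal M(G,X,x_0)=\mathcal M_A$, and $\mathrm{T}(G,X,x_0)=[A]$. A non-empty subset $A\subseteq G$ is of minimal type if $\mathrm{T}(G,X,x_0)=[A]$ for some pointed minimal locally compact $G$-space $(X,x_0)$. For $A$ of minimal type, a minimal locally compact $G$-space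 $Z$ is a universal minimal $G$-space of type $A$ if for each pointed minimal locally compact $G$-space $(X,x_0)$ with $\mathrm{T}(G,X,x_0)=[A]$ there is a surjective proper continuous $G$-map $\varphi\colon Z\to X$. *)

theory Defs
  imports "HOL-Analysis.Analysis" "HOL-Algebra.Group_Action"
begin

(* prefix notation of HOL-Algebra that clashes with the topological closure *)
no_notation eq_closure_of (\<open>closure'_of\<index>\<close>)

section \<open>Locally compact \<open>G\<close>-spaces\<close>

text \<open>
  \<open>G\<close> carries the discrete topology, so there is no joint continuity condition on the action.
  In \<^locale>\<open>group_action\<close> the maps \<open>\<phi> g\<close> are extensional, i.e. \<open>undefined\<close> outside
  \<open>topspace X\<close>.
\<close>

definition lc_G_space :: "('g, 'm) monoid_scheme \<Rightarrow> 'x topology \<Rightarrow> ('g \<Rightarrow> 'x \<Rightarrow> 'x) \<Rightarrow> bool" where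
  "lc_G_space G X \<phi> \<longleftrightarrow>
     group_action G (topspace X) \<phi> \<and> Hausdorff_space X \<and> locally_compact_space X \<and>
     (\<forall>g\<in>carrier G. homeomorphic_map X X (\<phi> g))"

definition minimal_lc_G_space :: "('g, 'm) monoid_scheme \<Rightarrow> 'x topology \<Rightarrow> ('g \<Rightarrow> 'x \<Rightarrow> 'x) \<Rightarrow> bool" where
  "minimal_lc_G_space G X \<phi> \<longleftrightarrow>
     lc_G_space G X \<phi> \<and> topspace X \<noteq> {} \<and>
     (\<forall>x\<in>topspace X. X closure_of orbit G \<phi> x = topspace X)"

definition cocompact_action :: "('g, 'm) monoid_scheme \<Rightarrow> 'x topology \<Rightarrow> ('g \<Rightarrow> 'x \<Rightarrow> 'x) \<Rightarrow> bool" where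
  "cocompact_action G X \<phi> \<longleftrightarrow> (\<exists>K. compactin X K \<and> (\<Union>g\<in>carrier G. \<phi> g ` K) = topspace X)"

definition pointed_lc_G_space ::
    "('g, 'm) monoid_scheme \<Rightarrow> 'x topology \<Rightarrow> ('g \<Rightarrow> 'x \<Rightarrow> 'x) \<Rightarrow> 'x \<Rightarrow> bool" where
  "pointed_lc_G_space G X \<phi> x0 \<longleftrightarrow>
     lc_G_space G X \<phi> \<and> x0 \<in> topspace X \<and> X closure_of orbit G \<phi> x0 = topspace X"

definition G_equivariant ::
    "('g, 'm) monoid_scheme \<Rightarrow> 'x topology \<Rightarrow> ('g \<Rightarrow> 'x \<Rightarrow> 'x) \<Rightarrow> ('g \<Rightarrow> 'y \<Rightarrow> 'y) \<Rightarrow> ('x \<Rightarrow> 'y) \<Rightarrow> bool" where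
  "G_equivariant G X \<phi> \<psi> f \<longleftrightarrow> (\<forall>g\<in>carrier G. \<forall>x\<in>topspace X. f (\<phi> g x) = \<psi> g (f x))"

text \<open>
  Properness means that preimages of compact sets are compact. (The library's
  \<^const>\<open>proper_map\<close> asks for closed maps with compact fibres instead.)
\<close>

definition proper_surjective_G_map ::
    "('g, 'm) monoid_scheme \<Rightarrow> 'x topology \<Rightarrow> ('g \<Rightarrow> 'x \<Rightarrow> 'x) \<Rightarrow> 'y topology \<Rightarrow> ('g \<Rightarrow> 'y \<Rightarrow> 'y)
     \<Rightarrow> ('x \<Rightarrow> 'y) \<Rightarrow> bool" where
  "proper_surjective_G_map G X \<phi> Y \<psi> f \<longleftrightarrow>
     continuous_map X Y f \<and>
     (\<forall>K. compactin Y K \<longrightarrow> compactin X {x \<in> topspace X. f x \<in> K}) \<and>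
     f ` topspace X = topspace Y \<and>
     G_equivariant G X \<phi> \<psi> f"

definition isomorphic_G_spaces ::
    "('g, 'm) monoid_scheme \<Rightarrow> 'x topology \<Rightarrow> ('g \<Rightarrow> 'x \<Rightarrow> 'x) \<Rightarrow> 'y topology \<Rightarrow> ('g \<Rightarrow> 'y \<Rightarrow> 'y)
     \<Rightarrow> bool" where
  "isomorphic_G_spaces G X \<phi> Y \<psi> \<longleftrightarrow> (\<exists>h. homeomorphic_map X Y h \<and> G_equivariant G X \<phi> \<psi> h)"


section \<open>Types\<close>

definition sub_finite_translates :: "('g, 'm) monoid_scheme \<Rightarrow> 'g set \<Rightarrow> 'g set \<Rightarrow> bool" where
  "sub_finite_translates G A B \<longleftrightarrow> (\<exists>F. finite F \<and> F \<subseteq> carrier G \<and> A \<subseteq> F <#>\<^bsub>G\<^esub> B)"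

definition translate_equiv :: "('g, 'm) monoid_scheme \<Rightarrow> 'g set \<Rightarrow> 'g set \<Rightarrow> bool" where
  "translate_equiv G A B \<longleftrightarrow> sub_finite_translates G A B \<and> sub_finite_translates G B A"

definition translate_class :: "('g, 'm) monoid_scheme \<Rightarrow> 'g set \<Rightarrow> 'g set set" where
  "translate_class G A = {B. B \<subseteq> carrier G \<and> B \<noteq> {} \<and> translate_equiv G B A}"

definition translate_ideal :: "('g, 'm) monoid_scheme \<Rightarrow> 'g set \<Rightarrow> 'g set set" where
  "translate_ideal G A = {B. B \<subseteq> carrier G \<and> sub_finite_translates G B A}"

definition rel_compact_sets ::
    "('g, 'm) monoid_scheme \<Rightarrow> 'x topology \<Rightarrow> ('g \<Rightarrow> 'x \<Rightarrow> 'x) \<Rightarrow> 'x \<Rightarrow> 'g set set" where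
  "rel_compact_sets G X \<phi> x0 =
     {B. B \<subseteq> carrier G \<and> compactin X (X closure_of ((\<lambda>g. \<phi> g x0) ` B))}"

text \<open>
  Well defined for cocompact spaces, see \<open>G_type_well_defined\<close> and \<open>G_type_eq_iff\<close> below.
\<close>

definition G_type ::
    "('g, 'm) monoid_scheme \<Rightarrow> 'x topology \<Rightarrow> ('g \<Rightarrow> 'x \<Rightarrow> 'x) \<Rightarrow> 'x \<Rightarrow> 'g set set" where
  "G_type G X \<phi> x0 =
     (THE T. \<exists>A. A \<subseteq> carrier G \<and> A \<noteq> {} \<and> rel_compact_sets G X \<phi> x0 = translate_ideal G A \<and>
                 T = translate_class G A)"


section \<open>Universal minimal spaces of a given type\<close>

text \<open>
  HOL cannot quantify over spaces with points of arbitrary type inside a formula. In the next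
  two definitions the points of the test spaces range over the type \<^typ>\<open>'g set set\<close>. This
  is no restriction: a Hausdorff space with a dense orbit \<open>G.x0\<close> injects into the sets of
  subsets of \<open>G\<close> by \<open>x \<mapsto> {B. x \<in> closure (B.x0)}\<close>, so it is isomorphic to a \<open>G\<close>-space
  on this type. The lemmas \<open>minimal_typeI\<close> and \<open>universal_minimal_G_spaceD\<close> below give
  both notions for test spaces over an arbitrary type.
\<close>

definition minimal_type :: "('g, 'm) monoid_scheme \<Rightarrow> 'g set \<Rightarrow> bool" where
  "minimal_type G A \<longleftrightarrow>
     A \<subseteq> carrier G \<and> A \<noteq> {} \<and>
     (\<exists>(X :: 'g set set topology) \<phi> x0.
        minimal_lc_G_space G X \<phi> \<and> pointed_lc_G_space G X \<phi> x0 \<and>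
        G_type G X \<phi> x0 = translate_class G A)"

definition universal_minimal_G_space ::
    "('g, 'm) monoid_scheme \<Rightarrow> 'g set \<Rightarrow> 'z topology \<Rightarrow> ('g \<Rightarrow> 'z \<Rightarrow> 'z) \<Rightarrow> bool" where
  "universal_minimal_G_space G A Z \<zeta> \<longleftrightarrow>
     minimal_lc_G_space G Z \<zeta> \<and>
     (\<forall>(X :: 'g set set topology) \<phi> x0.
        minimal_lc_G_space G X \<phi> \<and> pointed_lc_G_space G X \<phi> x0 \<and>
        G_type G X \<phi> x0 = translate_class G A
        \<longrightarrow> (\<exists>f. proper_surjective_G_map G Z \<zeta> X \<phi> f))"


section \<open>The type is well defined\<close>

context group
begin

lemma sub_finite_translates_refl: "A \<subseteq> carrier G \<Longrightarrow> sub_finite_translates G A A"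
  unfolding sub_finite_translates_def set_mult_def
  by (rule exI[of _ "{\<one>}"]) force

lemma sub_finite_translates_trans:
  assumes "C \<subseteq> carrier G" "sub_finite_translates G A B" "sub_finite_translates G B C"
  shows "sub_finite_translates G A C"
proof -
  obtain E F where E: "finite E" "E \<subseteq> carrier G" "A \<subseteq> E <#> B"
    and F: "finite F" "F \<subseteq> carrier G" "B \<subseteq> F <#> C"
    using assms unfolding sub_finite_translates_def by blast
  have "A \<subseteq> E <#> (F <#> C)"
    using E(3) F(3) mono_set_mult by blast
  then have "A \<subseteq> (E <#> F) <#> C"
    using set_mult_assoc[OF E(2) F(2) assms(1)] by simp
  moreover have "finite (E <#> F)"
  proof -
    have "E <#> F = (\<lambda>(x, y). x \<otimes> y) ` (E \<times> F)"
      by (auto simp: set_mult_def)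
    then show ?thesis
      using E(1) F(1) by simp
  qed
  ultimately show ?thesis
    unfolding sub_finite_translates_def using set_mult_closed[OF E(2) F(2)] by blast
qed

lemma translate_ideal_eq_iff:
  assumes "A \<subseteq> carrier G" "B \<subseteq> carrier G"
  shows "translate_ideal G A = translate_ideal G B \<longleftrightarrow> translate_equiv G A B"
  unfolding translate_ideal_def translate_equiv_def
  using assms sub_finite_translates_refl sub_finite_translates_trans by blast

lemma translate_class_eq_iff:
  assumes "A \<subseteq> carrier G" "A \<noteq> {}" "B \<subseteq> carrier G"
  shows "translate_class G A = translate_class G B \<longleftrightarrow> translate_equiv G A B"
proof
  assume "translate_class G A = translate_class G B"
  moreover have "A \<in> translate_class G A"
    using assms sub_finite_translates_refl by (auto simp: translate_class_def translate_equiv_def)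
  ultimately show "translate_equiv G A B"
    by (auto simp: translate_class_def)
next
  assume "translate_equiv G A B"
  then show "translate_class G A = translate_class G B"
    unfolding translate_class_def translate_equiv_def
    using assms sub_finite_translates_trans by blast
qed

lemma G_type_eqI:
  assumes "A \<subseteq> carrier G" "A \<noteq> {}" "rel_compact_sets G X \<phi> x0 = translate_ideal G A"
  shows "G_type G X \<phi> x0 = translate_class G A"
  unfolding G_type_def
proof (rule the_equality)
  show "\<exists>A'. A' \<subseteq> carrier G \<and> A' \<noteq> {} \<and> rel_compact_sets G X \<phi> x0 = translate_ideal G A' \<and>
             translate_class G A = translate_class G A'"
    using assms by blast
next
  fix T
  assume "\<exists>A'. A' \<subseteq> carrier G \<and> A' \<noteq> {} \<and> rel_compact_sets G X \<phi> x0 = translate_ideal G A' \<and>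
               T = translate_class G A'"
  then show "T = translate_class G A"
    using assms translate_ideal_eq_iff translate_class_eq_iff by metis
qed

end

lemma lc_G_space_imp_group: "lc_G_space G X \<phi> \<Longrightarrow> group G"
  unfolding lc_G_space_def using group_action.group_hom group_hom.axioms(1) by blast

lemma minimal_imp_cocompact:
  fixes G (structure)
  assumes "minimal_lc_G_space G X \<phi>"
  shows "cocompact_action G X \<phi>"
proof -
  have lc: "lc_G_space G X \<phi>" and ne: "topspace X \<noteq> {}"
    and dense: "\<And>x. x \<in> topspace X \<Longrightarrow> X closure_of orbit G \<phi> x = topspace X"
    using assms by (auto simp: minimal_lc_G_space_def)
  interpret group_action G "topspace X" \<phi>
    using lc by (simp add: lc_G_space_def)
  interpret group G
    using lc by (rule lc_G_space_imp_group)
  obtain x where "x \<in> topspace X"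
    using ne by blast
  then obtain U K where U: "openin X U" and K: "compactin X K" and "x \<in> U" "U \<subseteq> K"
    using lc unfolding lc_G_space_def locally_compact_space_def by blast
  have "(\<Union>g\<in>carrier G. \<phi> g ` K) = topspace X"
  proof (intro equalityI subsetI)
    fix y assume "y \<in> (\<Union>g\<in>carrier G. \<phi> g ` K)"
    then show "y \<in> topspace X"
      using element_image compactin_subset_topspace[OF K] by blast
  next
    fix y assume y: "y \<in> topspace X"
    have "x \<in> X closure_of orbit G \<phi> y"
      using dense[OF y] \<open>x \<in> topspace X\<close> by simp
    then obtain g where g: "g \<in> carrier G" "\<phi> g y \<in> U"
      using U \<open>x \<in> U\<close> unfolding in_closure_of orbit_def by blast
    then have "\<phi> (inv g) (\<phi> g y) = y"
      using orbit_sym_aux y by blast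
    then have "y \<in> \<phi> (inv g) ` K"
      using g \<open>U \<subseteq> K\<close> by (metis imageI subsetD)
    then show "y \<in> (\<Union>g\<in>carrier G. \<phi> g ` K)"
      using g inv_closed by blast
  qed
  then show ?thesis
    using K unfolding cocompact_action_def by blast
qed

lemma G_type_well_defined:
  fixes G (structure)
  assumes pt: "pointed_lc_G_space G X \<phi> x0" and cc: "cocompact_action G X \<phi>"
  shows "\<exists>A. A \<subseteq> carrier G \<and> A \<noteq> {} \<and> rel_compact_sets G X \<phi> x0 = translate_ideal G A"
proof -
  have lc: "lc_G_space G X \<phi>" and x0: "x0 \<in> topspace X"
    and dense: "X closure_of orbit G \<phi> x0 = topspace X"
    using pt by (auto simp: pointed_lc_G_space_def)
  have haus: "Hausdorff_space X" and lcs: "locally_compact_space X"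
    and homeo: "\<And>g. g \<in> carrier G \<Longrightarrow> homeomorphic_map X X (\<phi> g)"
    using lc by (auto simp: lc_G_space_def)
  interpret group_action G "topspace X" \<phi>
    using lc by (simp add: lc_G_space_def)
  interpret group G
    using lc by (rule lc_G_space_imp_group)
  obtain K where K: "compactin X K" "(\<Union>g\<in>carrier G. \<phi> g ` K) = topspace X"
    using cc unfolding cocompact_action_def by blast
  have "regular_space X"
    using haus lcs locally_compact_Hausdorff_imp_regular_space by blast
  then obtain U L where U: "openin X U" and L: "compactin X L" and "K \<subseteq> U" "U \<subseteq> L"
    using K(1) lcs locally_compact_space_compact_closed_compact by metis
  define A where "A = {g \<in> carrier G. \<phi> g x0 \<in> U}"
  have AG: "A \<subseteq> carrier G"
    by (auto simp: A_def)
  have "A \<noteq> {}"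
  proof -
    obtain k where "k \<in> K"
      using K(2) x0 by blast
    then have "k \<in> U" "k \<in> topspace X"
      using \<open>K \<subseteq> U\<close> U openin_subset by blast+
    then have "k \<in> X closure_of orbit G \<phi> x0"
      using dense by simp
    then show ?thesis
      using U \<open>k \<in> U\<close> unfolding in_closure_of orbit_def A_def by blast
  qed
  moreover have "rel_compact_sets G X \<phi> x0 = translate_ideal G A"
  proof (intro equalityI subsetI)
    fix B assume B: "B \<in> rel_compact_sets G X \<phi> x0"
    define C where "C = X closure_of ((\<lambda>g. \<phi> g x0) ` B)"
    have BG: "B \<subseteq> carrier G" and C: "compactin X C"
      using B by (auto simp: rel_compact_sets_def C_def)
    have cover: "C \<subseteq> \<Union> ((\<lambda>g. \<phi> g ` U) ` carrier G)"
    proof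
      fix c assume "c \<in> C"
      then have "c \<in> (\<Union>g\<in>carrier G. \<phi> g ` K)"
        using compactin_subset_topspace[OF C] K(2) by auto
      then show "c \<in> \<Union> ((\<lambda>g. \<phi> g ` U) ` carrier G)"
        using \<open>K \<subseteq> U\<close> by blast
    qed
    have opens: "openin X V" if "V \<in> (\<lambda>g. \<phi> g ` U) ` carrier G" for V
      using that U homeomorphic_map_openness[OF homeo openin_subset[OF U]] by auto
    obtain \<F> where \<F>: "finite \<F>" "\<F> \<subseteq> (\<lambda>g. \<phi> g ` U) ` carrier G" "C \<subseteq> \<Union>\<F>"
      using compactinD[OF C opens cover] by auto
    obtain F where F: "F \<subseteq> carrier G" "finite F" "C \<subseteq> \<Union> ((\<lambda>g. \<phi> g ` U) ` F)"
      using finite_subset_image[OF \<F>(1,2)] \<F>(3) by blast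
    have "B \<subseteq> F <#> A"
    proof
      fix b assume b: "b \<in> B"
      have bG: "b \<in> carrier G"
        using b BG by blast
      have "(\<lambda>g. \<phi> g x0) ` B \<subseteq> topspace X"
        using BG x0 element_image by blast
      then have "\<phi> b x0 \<in> C"
        using b closure_of_subset unfolding C_def by (metis imageI subsetD)
      then obtain f u where f: "f \<in> F" "u \<in> U" "\<phi> b x0 = \<phi> f u"
        using F(3) by blast
      have fG: "f \<in> carrier G"
        using f F by blast
      have "u \<in> topspace X"
        using U f openin_subset by blast
      then have "\<phi> (inv f) (\<phi> b x0) = u"
        using f fG orbit_sym_aux by metis
      then have "\<phi> (inv f \<otimes> b) x0 = u"
        using composition_rule x0 bG fG by simp
      then have "inv f \<otimes> b \<in> A"
        using f bG fG by (simp add: A_def)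
      moreover have "b = f \<otimes> (inv f \<otimes> b)"
        using bG fG by (simp add: m_assoc[symmetric])
      ultimately show "b \<in> F <#> A"
        using f unfolding set_mult_def by blast
    qed
    then show "B \<in> translate_ideal G A"
      using F BG unfolding translate_ideal_def sub_finite_translates_def by blast
  next
    fix B assume "B \<in> translate_ideal G A"
    then obtain F where BG: "B \<subseteq> carrier G" and F: "finite F" "F \<subseteq> carrier G" "B \<subseteq> F <#> A"
      unfolding translate_ideal_def sub_finite_translates_def by blast
    define M where "M = (\<Union>f\<in>F. \<phi> f ` L)"
    have M: "compactin X M"
      unfolding M_def
    proof (rule compactin_Union)
      fix S assume "S \<in> (\<lambda>f. \<phi> f ` L) ` F"
      then show "compactin X S"
        using F homeo L homeomorphic_imp_continuous_map image_compactin by blast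
    qed (use F in simp)
    have "(\<lambda>g. \<phi> g x0) ` B \<subseteq> M"
    proof (rule image_subsetI)
      fix b assume "b \<in> B"
      then obtain f a where fa: "f \<in> F" "a \<in> A" "b = f \<otimes> a"
        using F(3) unfolding set_mult_def by blast
      then have "\<phi> b x0 = \<phi> f (\<phi> a x0)"
        using composition_rule x0 AG F(2) by blast
      moreover have "\<phi> a x0 \<in> L"
        using fa \<open>U \<subseteq> L\<close> by (auto simp: A_def)
      ultimately show "\<phi> b x0 \<in> M"
        using fa unfolding M_def by blast
    qed
    then have "X closure_of ((\<lambda>g. \<phi> g x0) ` B) \<subseteq> M"
      using closure_of_minimal compactin_imp_closedin[OF haus M] by blast
    then have "compactin X (X closure_of ((\<lambda>g. \<phi> g x0) ` B))"
      using M closed_compactin closedin_closure_of by blast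
    then show "B \<in> rel_compact_sets G X \<phi> x0"
      using BG by (simp add: rel_compact_sets_def)
  qed
  ultimately show ?thesis
    using AG by blast
qed

lemma G_type_eq_iff:
  assumes "pointed_lc_G_space G X \<phi> x0" "cocompact_action G X \<phi>" "A \<subseteq> carrier G" "A \<noteq> {}"
  shows "G_type G X \<phi> x0 = translate_class G A \<longleftrightarrow> rel_compact_sets G X \<phi> x0 = translate_ideal G A"
proof -
  interpret group G
    using assms(1) lc_G_space_imp_group unfolding pointed_lc_G_space_def by blast
  show ?thesis
    using G_type_well_defined[OF assms(1,2)] G_type_eqI assms(3,4)
      translate_class_eq_iff translate_ideal_eq_iff by metis
qed


section \<open>Independence of the type of points\<close>

lemma lc_G_space_transport:
  fixes G (structure) and X :: "'x topology" and j :: "'x \<Rightarrow> 'y"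
  assumes lc: "lc_G_space G X \<phi>" and inj: "inj_on j (topspace X)"
  obtains Y :: "'y topology" and \<psi>
    where "lc_G_space G Y \<psi>" "homeomorphic_map X Y j" "G_equivariant G X \<phi> \<psi> j"
proof -
  interpret A: group_action G "topspace X" \<phi>
    using lc by (simp add: lc_G_space_def)
  interpret group G
    using lc by (rule lc_G_space_imp_group)
  define S where "S = j ` topspace X"
  define k where "k = inv_into (topspace X) j"
  define Y where "Y = pullback_topology S k X"
  define \<psi> where "\<psi> g = (\<lambda>y\<in>S. j (\<phi> g (k y)))" for g
  have kj: "k (j x) = x" if "x \<in> topspace X" for x
    using inj that by (simp add: k_def)
  have jk: "j (k y) = y" and kS: "k y \<in> topspace X" if "y \<in> S" for y
    using that by (auto simp: k_def S_def f_inv_into_f inv_into_into)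
  have jS: "j x \<in> S" if "x \<in> topspace X" for x
    using that by (simp add: S_def)
  have topY: "topspace Y = S"
    using kS by (auto simp: Y_def topspace_pullback_topology)
  have contk: "continuous_map Y X k"
    unfolding Y_def using continuous_map_pullback[OF continuous_map_id, of S k X] by simp
  have contj: "continuous_map X Y j"
    unfolding Y_def
  proof (rule continuous_map_pullback')
    show "continuous_map X X (k \<circ> j)"
      by (rule continuous_map_eq[OF continuous_map_id]) (simp add: kj)
    show "topspace X \<subseteq> j -` S"
      using jS by blast
  qed
  have hm: "homeomorphic_maps X Y j k"
    using contj contk kj jk topY by (simp add: homeomorphic_maps_def)
  then have hj: "homeomorphic_map X Y j"
    using homeomorphic_map_maps by blast
  have hk: "homeomorphic_map Y X k"
    using hm homeomorphic_maps_map by blast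
  have eq: "G_equivariant G X \<phi> \<psi> j"
    using kj jS by (simp add: G_equivariant_def \<psi>_def)
  have homeo: "homeomorphic_map Y Y (\<psi> g)" if g: "g \<in> carrier G" for g
  proof (rule homeomorphic_map_eq)
    have "homeomorphic_map X X (\<phi> g)"
      using lc g by (simp add: lc_G_space_def)
    then show "homeomorphic_map Y Y (j \<circ> (\<phi> g \<circ> k))"
      by (intro homeomorphic_map_compose[OF homeomorphic_map_compose[OF hk] hj])
  qed (simp add: \<psi>_def topY)
  have bij: "\<psi> g \<in> Bij S" if "g \<in> carrier G" for g
  proof -
    have "bij_betw (\<psi> g) S S"
      using homeomorphic_imp_injective_map[OF homeo[OF that]]
        homeomorphic_imp_surjective_map[OF homeo[OF that]] topY
      by (simp add: bij_betw_def)
    moreover have "\<psi> g \<in> extensional S"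
      by (simp add: \<psi>_def)
    ultimately show ?thesis
      by (simp add: Bij_def)
  qed
  have "group_hom G (BijGroup S) \<psi>"
  proof (intro group_hom.intro group_BijGroup group_hom_axioms.intro homI)
    show "group G" by (rule group_axioms)
  next
    fix g assume "g \<in> carrier G"
    then show "\<psi> g \<in> carrier (BijGroup S)"
      using bij by (simp add: BijGroup_def)
  next
    fix g h assume g: "g \<in> carrier G" and h: "h \<in> carrier G"
    have "\<psi> (g \<otimes> h) = compose S (\<psi> g) (\<psi> h)"
    proof (rule extensionalityI)
      show "\<psi> (g \<otimes> h) \<in> extensional S"
        by (simp add: \<psi>_def)
      show "compose S (\<psi> g) (\<psi> h) \<in> extensional S"
        by (rule compose_extensional)
      fix y assume y: "y \<in> S"
      have "\<phi> h (k y) \<in> topspace X"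
        using A.element_image h kS[OF y] by blast
      then show "\<psi> (g \<otimes> h) y = compose S (\<psi> g) (\<psi> h) y"
        using y kS jS kj g h by (simp add: \<psi>_def compose_def A.composition_rule)
    qed
    then show "\<psi> (g \<otimes> h) = \<psi> g \<otimes>\<^bsub>BijGroup S\<^esub> \<psi> h"
      using bij g h by (simp add: BijGroup_def)
  qed
  moreover have "X homeomorphic_space Y"
    using hj homeomorphic_map_imp_homeomorphic_space by blast
  then have "Hausdorff_space Y" "locally_compact_space Y"
    using lc homeomorphic_Hausdorff_space homeomorphic_locally_compact_space
    unfolding lc_G_space_def by blast+
  ultimately have "lc_G_space G Y \<psi>"
    using homeo topY by (simp add: lc_G_space_def group_action_def)
  then show thesis
    using that hj eq by blast
qed

lemma iso_closure_image:
  assumes lc: "lc_G_space G X \<phi>" and h: "homeomorphic_map X Y h" and eq: "G_equivariant G X \<phi> \<psi> h"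
    and x: "x \<in> topspace X" and B: "B \<subseteq> carrier G"
  shows "Y closure_of ((\<lambda>g. \<psi> g (h x)) ` B) = h ` (X closure_of ((\<lambda>g. \<phi> g x) ` B))"
proof -
  interpret group_action G "topspace X" \<phi>
    using lc by (simp add: lc_G_space_def)
  have sub: "(\<lambda>g. \<phi> g x) ` B \<subseteq> topspace X"
    using B x element_image by blast
  have "(\<lambda>g. \<psi> g (h x)) ` B = h ` ((\<lambda>g. \<phi> g x) ` B)"
    unfolding image_image using eq B x
    by (intro image_cong) (auto simp: G_equivariant_def)
  then show ?thesis
    using homeomorphic_map_closure_of[OF h sub] by simp
qed

lemma orbit_eq_image: "orbit G \<phi> x = (\<lambda>g. \<phi> g x) ` carrier G"
  by (auto simp: orbit_def)

lemma iso_orbit_closure: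
  assumes "lc_G_space G X \<phi>" "homeomorphic_map X Y h" "G_equivariant G X \<phi> \<psi> h" "x \<in> topspace X"
    and "X closure_of orbit G \<phi> x = topspace X"
  shows "Y closure_of orbit G \<psi> (h x) = topspace Y"
  using iso_closure_image[OF assms(1-4) order_refl] assms(5) homeomorphic_imp_surjective_map[OF assms(2)]
  by (simp add: orbit_eq_image)

lemma iso_minimal:
  assumes min: "minimal_lc_G_space G X \<phi>" and lcY: "lc_G_space G Y \<psi>" and h: "homeomorphic_map X Y h"
    and eq: "G_equivariant G X \<phi> \<psi> h"
  shows "minimal_lc_G_space G Y \<psi>"
proof -
  have lc: "lc_G_space G X \<phi>" and ne: "topspace X \<noteq> {}"
    and dense: "\<And>x. x \<in> topspace X \<Longrightarrow> X closure_of orbit G \<phi> x = topspace X"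
    using min by (auto simp: minimal_lc_G_space_def)
  have Y: "topspace Y = h ` topspace X"
    using homeomorphic_imp_surjective_map[OF h] by simp
  have "Y closure_of orbit G \<psi> y = topspace Y" if "y \<in> topspace Y" for y
  proof -
    obtain x where "x \<in> topspace X" "y = h x"
      using \<open>y \<in> topspace Y\<close> Y by blast
    then show ?thesis
      using iso_orbit_closure[OF lc h eq _ dense] by blast
  qed
  then show ?thesis
    using lcY ne Y unfolding minimal_lc_G_space_def by blast
qed

lemma iso_pointed:
  assumes pt: "pointed_lc_G_space G X \<phi> x0" and lcY: "lc_G_space G Y \<psi>" and h: "homeomorphic_map X Y h"
    and eq: "G_equivariant G X \<phi> \<psi> h"
  shows "pointed_lc_G_space G Y \<psi> (h x0)"
proof -
  have lc: "lc_G_space G X \<phi>" and x0: "x0 \<in> topspace X"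
    and dense: "X closure_of orbit G \<phi> x0 = topspace X"
    using pt by (auto simp: pointed_lc_G_space_def)
  have "h x0 \<in> topspace Y"
    using homeomorphic_imp_surjective_map[OF h] x0 by blast
  then show ?thesis
    using lcY iso_orbit_closure[OF lc h eq x0 dense] unfolding pointed_lc_G_space_def by blast
qed

lemma iso_G_type:
  assumes lc: "lc_G_space G X \<phi>" and h: "homeomorphic_map X Y h" and eq: "G_equivariant G X \<phi> \<psi> h"
    and x0: "x0 \<in> topspace X"
  shows "G_type G Y \<psi> (h x0) = G_type G X \<phi> x0"
proof -
  have "compactin Y (Y closure_of ((\<lambda>g. \<psi> g (h x0)) ` B)) \<longleftrightarrow>
        compactin X (X closure_of ((\<lambda>g. \<phi> g x0) ` B))" if "B \<subseteq> carrier G" for B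
    using iso_closure_image[OF lc h eq x0 that] homeomorphic_map_compactness[OF h closure_of_subset_topspace]
    by simp
  then have "rel_compact_sets G Y \<psi> (h x0) = rel_compact_sets G X \<phi> x0"
    by (auto simp: rel_compact_sets_def)
  then show ?thesis
    by (simp add: G_type_def)
qed

lemma pointed_inj_on:
  assumes pt: "pointed_lc_G_space G X \<phi> x0"
  shows "inj_on (\<lambda>x. {B. B \<subseteq> carrier G \<and> x \<in> X closure_of ((\<lambda>g. \<phi> g x0) ` B)}) (topspace X)"
proof (rule inj_onI)
  fix x y assume x: "x \<in> topspace X" and y: "y \<in> topspace X"
    and eq: "{B. B \<subseteq> carrier G \<and> x \<in> X closure_of ((\<lambda>g. \<phi> g x0) ` B)} =
             {B. B \<subseteq> carrier G \<and> y \<in> X closure_of ((\<lambda>g. \<phi> g x0) ` B)}"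
  have "Hausdorff_space X" and dense: "X closure_of orbit G \<phi> x0 = topspace X"
    using pt by (auto simp: pointed_lc_G_space_def lc_G_space_def)
  show "x = y"
  proof (rule ccontr)
    assume "x \<noteq> y"
    then obtain U V where U: "openin X U" "x \<in> U" and V: "openin X V" "y \<in> V" and "disjnt U V"
      using \<open>Hausdorff_space X\<close> x y unfolding Hausdorff_space_def by metis
    define B where "B = {g \<in> carrier G. \<phi> g x0 \<in> U}"
    have "x \<in> X closure_of ((\<lambda>g. \<phi> g x0) ` B)"
      unfolding in_closure_of
    proof (intro conjI x allI impI)
      fix T assume T: "x \<in> T \<and> openin X T"
      then have "openin X (T \<inter> U)" "x \<in> T \<inter> U"
        using U by auto
      moreover have "x \<in> X closure_of orbit G \<phi> x0"
        using dense x by simp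
      ultimately obtain g where "g \<in> carrier G" "\<phi> g x0 \<in> T \<inter> U"
        unfolding in_closure_of orbit_def by blast
      then show "\<exists>z. z \<in> (\<lambda>g. \<phi> g x0) ` B \<and> z \<in> T"
        unfolding B_def by blast
    qed
    then have "y \<in> X closure_of ((\<lambda>g. \<phi> g x0) ` B)"
      using eq unfolding B_def by blast
    then have "\<exists>z. z \<in> (\<lambda>g. \<phi> g x0) ` B \<and> z \<in> V"
      using V unfolding in_closure_of by blast
    then show False
      using \<open>disjnt U V\<close> unfolding B_def disjnt_def by blast
  qed
qed

lemma pointed_representative:
  fixes X :: "'x topology" and G :: "('g, 'm) monoid_scheme"
  assumes min: "minimal_lc_G_space G X \<phi>" and pt: "pointed_lc_G_space G X \<phi> x0"
  obtains Y :: "'g set set topology" and \<psi> h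
    where "minimal_lc_G_space G Y \<psi>" "pointed_lc_G_space G Y \<psi> (h x0)"
      "G_type G Y \<psi> (h x0) = G_type G X \<phi> x0"
      "homeomorphic_map X Y h" "G_equivariant G X \<phi> \<psi> h"
proof -
  have lc: "lc_G_space G X \<phi>" and x0: "x0 \<in> topspace X"
    using pt by (auto simp: pointed_lc_G_space_def)
  obtain Y :: "'g set set topology" and \<psi> h
    where Y: "lc_G_space G Y \<psi>" "homeomorphic_map X Y h" "G_equivariant G X \<phi> \<psi> h"
    using lc_G_space_transport[OF lc pointed_inj_on[OF pt]] by blast
  then show thesis
    using that[of Y \<psi> h] iso_minimal[OF min Y] iso_pointed[OF pt Y] iso_G_type[OF lc Y(2,3) x0]
    by blast
qed

lemma minimal_typeI:
  fixes X :: "'x topology"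
  assumes "A \<subseteq> carrier G" "A \<noteq> {}"
    and "minimal_lc_G_space G X \<phi>" "pointed_lc_G_space G X \<phi> x0" "G_type G X \<phi> x0 = translate_class G A"
  shows "minimal_type G A"
  using pointed_representative[OF assms(3,4)] assms unfolding minimal_type_def by metis

lemma universal_minimal_G_spaceD:
  fixes X :: "'x topology"
  assumes uni: "universal_minimal_G_space G A Z \<zeta>"
    and min: "minimal_lc_G_space G X \<phi>" and pt: "pointed_lc_G_space G X \<phi> x0"
    and ty: "G_type G X \<phi> x0 = translate_class G A"
  shows "\<exists>f. proper_surjective_G_map G Z \<zeta> X \<phi> f"
proof -
  obtain Y :: "'a set set topology" and \<psi> h
    where Y: "minimal_lc_G_space G Y \<psi>" "pointed_lc_G_space G Y \<psi> (h x0)"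
      "G_type G Y \<psi> (h x0) = G_type G X \<phi> x0"
    and h: "homeomorphic_map X Y h" and eqh: "G_equivariant G X \<phi> \<psi> h"
    using pointed_representative[OF min pt] by blast
  obtain f where f: "proper_surjective_G_map G Z \<zeta> Y \<psi> f"
    using uni Y ty unfolding universal_minimal_G_space_def by metis
  obtain k where hk: "homeomorphic_maps X Y h k"
    using h homeomorphic_map_maps by blast
  have k: "homeomorphic_map Y X k"
    using hk homeomorphic_maps_map by blast
  have kh: "k (h x) = x" if "x \<in> topspace X" for x
    using hk that by (simp add: homeomorphic_maps_def)
  have hk': "h (k y) = y" if "y \<in> topspace Y" for y
    using hk that by (simp add: homeomorphic_maps_def)
  have ksurj: "k ` topspace Y = topspace X"
    using k by (rule homeomorphic_imp_surjective_map)
  have fY: "f z \<in> topspace Y" if "z \<in> topspace Z" for z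
    using f that unfolding proper_surjective_G_map_def by blast
  interpret AX: group_action G "topspace X" \<phi>
    using min by (simp add: minimal_lc_G_space_def lc_G_space_def)
  have "proper_surjective_G_map G Z \<zeta> X \<phi> (k \<circ> f)"
    unfolding proper_surjective_G_map_def
  proof (intro conjI allI impI)
    show "continuous_map Z X (k \<circ> f)"
      using f unfolding proper_surjective_G_map_def
      by (blast intro: continuous_map_compose homeomorphic_imp_continuous_map[OF k])
  next
    fix K assume K: "compactin X K"
    have hK: "compactin Y (h ` K)"
      using K h homeomorphic_imp_continuous_map image_compactin by blast
    have "{z \<in> topspace Z. (k \<circ> f) z \<in> K} = {z \<in> topspace Z. f z \<in> h ` K}"
    proof (intro Collect_cong conj_cong refl)
      fix z assume z: "z \<in> topspace Z"
      show "(k \<circ> f) z \<in> K \<longleftrightarrow> f z \<in> h ` K"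
        using fY[OF z] hk' kh compactin_subset_topspace[OF K] by (force simp: image_iff)
    qed
    then show "compactin Z {z \<in> topspace Z. (k \<circ> f) z \<in> K}"
      using f hK unfolding proper_surjective_G_map_def by simp
  next
    show "(k \<circ> f) ` topspace Z = topspace X"
      using f ksurj unfolding proper_surjective_G_map_def by (metis image_comp)
  next
    show "G_equivariant G Z \<zeta> \<phi> (k \<circ> f)"
      unfolding G_equivariant_def
    proof (intro ballI)
      fix g z assume g: "g \<in> carrier G" and z: "z \<in> topspace Z"
      have x: "k (f z) \<in> topspace X"
        using fY[OF z] ksurj by blast
      have "f (\<zeta> g z) = \<psi> g (f z)"
        using f g z unfolding proper_surjective_G_map_def G_equivariant_def by blast
      also have "\<dots> = h (\<phi> g (k (f z)))"
        using eqh g x hk'[OF fY[OF z]] unfolding G_equivariant_def by metis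
      finally show "(k \<circ> f) (\<zeta> g z) = \<phi> g ((k \<circ> f) z)"
        using kh AX.element_image[OF g x] by simp
    qed
  qed
  then show ?thesis
    by blast
qed

end

theory Submission
  imports Defs
begin

text \<open>
  Fix a point \<open>z0\<close> of type \<open>A\<close> in \<open>Z1\<close> and let \<open>I\<close> be the set of all points of \<open>Z1\<close> of that type. The
  closure \<open>E\<close> of \<open>G\<close> in the space of maps \<open>I \<rightarrow> Z1\<close> is a locally compact substitute for the Ellis
  semigroup, and each evaluation \<open>E \<rightarrow> Z1\<close> is proper. Let \<open>M\<close> be a minimal closed invariant subset of
  \<open>E\<close>. The elements of \<open>M\<close> that map \<open>I\<close> to \<open>I\<close> act on \<open>M\<close> by right composition. The Ellis-Numakura
  lemma, applied to the compact semigroup of the elements fixing one such element, yields an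
  idempotent \<open>u\<close>, which is a right identity of \<open>M\<close>. Hence every proper endomorphism \<open>k\<close> of \<open>M\<close> is right
  composition with \<open>k u\<close>, and by minimality it is invertible. Universality gives maps
  \<open>M \<rightarrow> Z1 \<rightarrow> Z2 \<rightarrow> M\<close> whose composite is injective, so the surjection \<open>Z1 \<rightarrow> Z2\<close> is a homeomorphism.
\<close>

section \<open>Proper maps between \<open>G\<close>-spaces\<close>

text \<open>Continuity of each \<open>\<phi> g\<close> suffices because
  \<open>\<phi> (inv g)\<close> is a continuous inverse. Extensionality is what membership in
  \<open>Bij\<close> requires.\<close>

lemma lc_G_spaceI:
  fixes G (structure)
  assumes "group G" "Hausdorff_space X" "locally_compact_space X"
    and ext: "\<And>g. g \<in> carrier G \<Longrightarrow> \<phi> g \<in> extensional (topspace X)"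
    and cont: "\<And>g. g \<in> carrier G \<Longrightarrow> continuous_map X X (\<phi> g)"
    and one: "\<And>x. x \<in> topspace X \<Longrightarrow> \<phi> \<one> x = x"
    and mult: "\<And>g h x. g \<in> carrier G \<Longrightarrow> h \<in> carrier G \<Longrightarrow> x \<in> topspace X \<Longrightarrow>
                 \<phi> (g \<otimes> h) x = \<phi> g (\<phi> h x)"
  shows "lc_G_space G X \<phi>"
proof -
  interpret group G by fact
  have inv1: "\<phi> (inv g) (\<phi> g x) = x" and inv2: "\<phi> g (\<phi> (inv g) x) = x"
    if "g \<in> carrier G" "x \<in> topspace X" for g x
    using mult[of "inv g" g x] mult[of g "inv g" x] one that by simp_all
  have homeo: "homeomorphic_map X X (\<phi> g)" if "g \<in> carrier G" for g
  proof -
    have "homeomorphic_maps X X (\<phi> g) (\<phi> (inv g))"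
      unfolding homeomorphic_maps_def using that cont inv1 inv2 by simp
    then show ?thesis
      using homeomorphic_map_maps by blast
  qed
  have bij: "\<phi> g \<in> Bij (topspace X)" if "g \<in> carrier G" for g
    using homeo[OF that] ext[OF that]
    by (simp add: Bij_def bij_betw_def homeomorphic_imp_injective_map homeomorphic_imp_surjective_map)
  have "group_hom G (BijGroup (topspace X)) \<phi>"
  proof (intro group_hom.intro group_BijGroup group_hom_axioms.intro homI)
    show "group G" by fact
  next
    fix g assume "g \<in> carrier G"
    then show "\<phi> g \<in> carrier (BijGroup (topspace X))"
      using bij by (simp add: BijGroup_def)
  next
    fix g h assume gh: "g \<in> carrier G" "h \<in> carrier G"
    have "\<phi> (g \<otimes> h) = compose (topspace X) (\<phi> g) (\<phi> h)"
      by (rule extensionalityI[OF ext]) (use gh mult in \<open>simp_all add: compose_eq\<close>)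
    then show "\<phi> (g \<otimes> h) = \<phi> g \<otimes>\<^bsub>BijGroup (topspace X)\<^esub> \<phi> h"
      using bij gh by (simp add: BijGroup_def)
  qed
  then show ?thesis
    using assms(2,3) homeo by (simp add: lc_G_space_def group_action_def)
qed

text \<open>A locally compact Hausdorff codomain is a k-space, so compact preimages force the map to
  be closed. This connects properness in the sense of compact preimages with the library
  notion.\<close>

lemma proper_map_if_compact_preimages:
  assumes "Hausdorff_space Y" "locally_compact_space Y" "continuous_map X Y f"
    and "\<And>K. compactin Y K \<Longrightarrow> compactin X {x \<in> topspace X. f x \<in> K}"
  shows "proper_map X Y f"
  by (rule compact_imp_proper_map)
    (use assms in \<open>simp_all add: continuous_map_funspace Hausdorff_imp_kc_space
      locally_compact_imp_k_space\<close>)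

text \<open>Surjectivity is automatic: the image is closed by properness and contains an orbit,
  which is dense by minimality.\<close>

lemma proper_surjective_G_mapI:
  fixes G (structure)
  assumes ne: "topspace X \<noteq> {}"
    and min: "minimal_lc_G_space G Y \<psi>"
    and cont: "continuous_map X Y f"
    and comp: "\<And>K. compactin Y K \<Longrightarrow> compactin X {x \<in> topspace X. f x \<in> K}"
    and eq: "G_equivariant G X \<phi> \<psi> f"
    and act: "\<And>g x. g \<in> carrier G \<Longrightarrow> x \<in> topspace X \<Longrightarrow> \<phi> g x \<in> topspace X"
  shows "proper_surjective_G_map G X \<phi> Y \<psi> f"
proof -
  obtain x where x: "x \<in> topspace X"
    using ne by blast
  have fX: "f ` topspace X \<subseteq> topspace Y"
    using cont by (simp add: continuous_map_image_subset_topspace)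
  have "closed_map X Y f"
    using proper_map_if_compact_preimages[OF _ _ cont comp] min
    by (simp add: minimal_lc_G_space_def lc_G_space_def proper_imp_closed_map)
  then have cl: "closedin Y (f ` topspace X)"
    by (simp add: closed_map_def)
  have "orbit G \<psi> (f x) \<subseteq> f ` topspace X"
  proof
    fix y assume "y \<in> orbit G \<psi> (f x)"
    then obtain g where g: "g \<in> carrier G" "y = \<psi> g (f x)"
      by (auto simp: orbit_def)
    then have "y = f (\<phi> g x)"
      using eq x by (simp add: G_equivariant_def)
    then show "y \<in> f ` topspace X"
      using act[OF g(1) x] by blast
  qed
  then have "Y closure_of orbit G \<psi> (f x) \<subseteq> f ` topspace X"
    using cl by (simp add: closure_of_minimal)
  moreover have "Y closure_of orbit G \<psi> (f x) = topspace Y"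
    using min x fX by (auto simp: minimal_lc_G_space_def)
  ultimately show ?thesis
    using cont comp eq fX unfolding proper_surjective_G_map_def by blast
qed

lemma proper_surjective_G_map_compose:
  assumes f: "proper_surjective_G_map G X \<phi> Y \<psi> f" and h: "proper_surjective_G_map G Y \<psi> Z \<zeta> h"
  shows "proper_surjective_G_map G X \<phi> Z \<zeta> (h \<circ> f)"
  unfolding proper_surjective_G_map_def
proof (intro conjI allI impI)
  have fY: "f x \<in> topspace Y" if "x \<in> topspace X" for x
    using f that unfolding proper_surjective_G_map_def by blast
  show "continuous_map X Z (h \<circ> f)"
    using f h unfolding proper_surjective_G_map_def by (blast intro: continuous_map_compose)
  show "(h \<circ> f) ` topspace X = topspace Z"
    using f h unfolding proper_surjective_G_map_def by (metis image_comp)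
  show "G_equivariant G X \<phi> \<zeta> (h \<circ> f)"
    using f h fY by (simp add: proper_surjective_G_map_def G_equivariant_def)
  fix K assume "compactin Z K"
  then have "compactin X {x \<in> topspace X. f x \<in> {y \<in> topspace Y. h y \<in> K}}"
    using f h unfolding proper_surjective_G_map_def by blast
  moreover have "{x \<in> topspace X. f x \<in> {y \<in> topspace Y. h y \<in> K}} = {x \<in> topspace X. (h \<circ> f) x \<in> K}"
    using fY by auto
  ultimately show "compactin X {x \<in> topspace X. (h \<circ> f) x \<in> K}"
    by simp
qed

text \<open>Compactness of orbit closures is pushed forward by continuity and pulled back by
  properness. Types are therefore invariant under these maps.\<close>

lemma proper_surjective_G_map_rel_compact_sets:
  assumes f: "proper_surjective_G_map G X \<phi> Y \<psi> f"
    and X: "lc_G_space G X \<phi>" and Y: "lc_G_space G Y \<psi>" and x: "x \<in> topspace X"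
  shows "rel_compact_sets G Y \<psi> (f x) = rel_compact_sets G X \<phi> x"
proof -
  interpret group_action G "topspace X" \<phi>
    using X by (simp add: lc_G_space_def)
  have haus: "Hausdorff_space Y"
    using Y by (simp add: lc_G_space_def)
  have cont: "continuous_map X Y f"
    using f by (simp add: proper_surjective_G_map_def)
  have "compactin Y (Y closure_of ((\<lambda>g. \<psi> g (f x)) ` B)) \<longleftrightarrow>
        compactin X (X closure_of ((\<lambda>g. \<phi> g x) ` B))" (is "compactin Y ?D \<longleftrightarrow> compactin X ?C")
    if B: "B \<subseteq> carrier G" for B
  proof -
    have sub: "(\<lambda>g. \<phi> g x) ` B \<subseteq> topspace X"
      using B x element_image by blast
    have img: "(\<lambda>g. \<psi> g (f x)) ` B = f ` ((\<lambda>g. \<phi> g x) ` B)"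
      unfolding image_image using f B x
      by (intro image_cong) (auto simp: proper_surjective_G_map_def G_equivariant_def)
    show ?thesis
    proof
      assume D: "compactin Y ?D"
      let ?P = "{x \<in> topspace X. f x \<in> ?D}"
      have "f ` ((\<lambda>g. \<phi> g x) ` B) \<subseteq> ?D"
        unfolding img using sub cont
        by (intro closure_of_subset) (auto simp: continuous_map_def)
      then have "(\<lambda>g. \<phi> g x) ` B \<subseteq> ?P"
        using sub by blast
      moreover have "closedin X ?P"
        using cont by (rule closedin_continuous_map_preimage) simp
      ultimately have "?C \<subseteq> ?P"
        by (rule closure_of_minimal)
      moreover have "compactin X ?P"
        using f D by (simp add: proper_surjective_G_map_def)
      ultimately show "compactin X ?C"
        by (simp add: closed_compactin)
    next
      assume C: "compactin X ?C"
      have fC: "compactin Y (f ` ?C)"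
        using C cont by (rule image_compactin)
      moreover have "?D \<subseteq> f ` ?C"
        unfolding img using fC haus closure_of_subset[OF sub]
        by (intro closure_of_minimal image_mono) (auto simp: compactin_imp_closedin)
      ultimately show "compactin Y ?D"
        by (simp add: closed_compactin)
    qed
  qed
  then show ?thesis
    by (auto simp: rel_compact_sets_def)
qed

lemma G_type_lift:
  assumes f: "proper_surjective_G_map G Y \<psi> X \<phi> f"
    and Y: "minimal_lc_G_space G Y \<psi>" and X: "minimal_lc_G_space G X \<phi>" and x: "x \<in> topspace X"
  obtains y where "y \<in> topspace Y" "G_type G Y \<psi> y = G_type G X \<phi> x"
proof -
  obtain y where y: "y \<in> topspace Y" "f y = x"
    using f x unfolding proper_surjective_G_map_def by (metis imageE)
  then have "rel_compact_sets G X \<phi> x = rel_compact_sets G Y \<psi> y"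
    using proper_surjective_G_map_rel_compact_sets[OF f] X Y by (auto simp: minimal_lc_G_space_def)
  then show thesis
    using that y by (simp add: G_type_def)
qed

lemma minimal_pointed:
  "minimal_lc_G_space G X \<phi> \<Longrightarrow> x \<in> topspace X \<Longrightarrow> pointed_lc_G_space G X \<phi> x"
  by (simp add: minimal_lc_G_space_def pointed_lc_G_space_def)

lemma proper_surjective_G_map_homeomorphic:
  assumes f: "proper_surjective_G_map G X \<phi> Y \<psi> f"
    and Y: "lc_G_space G Y \<psi>" and inj: "inj_on f (topspace X)"
  shows "homeomorphic_map X Y f"
proof (rule bijective_closed_imp_homeomorphic_map)
  show "closed_map X Y f"
    using f Y unfolding proper_surjective_G_map_def lc_G_space_def
    by (intro proper_imp_closed_map proper_map_if_compact_preimages) auto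
qed (use f inj in \<open>simp_all add: proper_surjective_G_map_def\<close>)

section \<open>Minimal closed sets and idempotents in compact semigroups\<close>

text \<open>The members of \<open>\<F>\<close> may be non-compact. The compact set \<open>K\<close>,
  which meets all of them, supplies the finite intersection property that keeps intersections of
  chains non-empty.\<close>

lemma minimal_closed_member:
  assumes K: "compactin X K" and ne: "\<F> \<noteq> {}"
    and cl: "\<And>N. N \<in> \<F> \<Longrightarrow> closedin X N" and meets: "\<And>N. N \<in> \<F> \<Longrightarrow> K \<inter> N \<noteq> {}"
    and Inter: "\<And>\<C>. \<C> \<noteq> {} \<Longrightarrow> \<C> \<subseteq> \<F> \<Longrightarrow> K \<inter> \<Inter>\<C> \<noteq> {} \<Longrightarrow> \<Inter>\<C> \<in> \<F>"
  shows "\<exists>M\<in>\<F>. \<forall>N\<in>\<F>. N \<subseteq> M \<longrightarrow> N = M"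
proof -
  \<comment> \<open>Complements turn the search for a minimal member into Zorn's lemma for maximal
    ones.\<close>
  have "\<exists>M\<in>uminus ` \<F>. \<forall>N\<in>uminus ` \<F>. M \<subseteq> N \<longrightarrow> N = M"
  proof (rule subset_Zorn_nonempty)
    show "uminus ` \<F> \<noteq> {}"
      using ne by simp
  next
    fix \<D> assume ne: "\<D> \<noteq> {}" and chain: "subset.chain (uminus ` \<F>) \<D>"
    define \<C> where "\<C> = uminus ` \<D>"
    have sub: "\<C> \<subseteq> \<F>"
      using chain unfolding \<C>_def subset_chain_def by auto
    have chain': "subset.chain \<F> \<C>"
      using chain sub unfolding \<C>_def subset_chain_def
      by simp
    have "K \<inter> \<Inter>\<C> \<noteq> {}"
    proof -
      have "K \<inter> \<Inter>\<B> \<noteq> {}" if "finite \<B>" "\<B> \<subseteq> \<C>" for \<B>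
      proof (cases "\<B> = {}")
        case True
        obtain D where "D \<in> \<D>"
          using ne by blast
        then have "K \<inter> - D \<noteq> {}"
          using sub by (intro meets) (auto simp: \<C>_def)
        then show ?thesis
          using True by auto
      next
        case False
        have "subset.chain \<F> \<B>"
          using chain' that(2) unfolding subset_chain_def by (meson subsetD subset_trans)
        then have "\<Inter>\<B> \<in> \<B>"
          using Inter_in_chain that(1) False by metis
        then show ?thesis
          using sub that(2) by (intro meets) auto
      qed
      moreover have "closedin X N" if "N \<in> \<C>" for N
        using that sub cl by blast
      ultimately show ?thesis
        using K[unfolded compactin_fip] by auto
    qed
    then have "\<Inter>\<C> \<in> \<F>"
      using Inter sub ne by (simp add: \<C>_def)
    moreover have "\<Union>\<D> = - \<Inter>\<C>"
      unfolding \<C>_def by auto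
    ultimately show "\<Union>\<D> \<in> uminus ` \<F>"
      by blast
  qed
  then obtain M where "M \<in> \<F>" and max: "\<And>N. N \<in> \<F> \<Longrightarrow> - M \<subseteq> - N \<Longrightarrow> - N = - M"
    by auto
  show ?thesis
  proof (intro bexI[OF _ \<open>M \<in> \<F>\<close>] ballI impI)
    fix N assume "N \<in> \<F>" "N \<subseteq> M"
    then have "- N = - M"
      by (intro max) auto
    then show "N = M"
      by simp
  qed
qed

text \<open>The Ellis-Numakura lemma: every element of a minimal closed subsemigroup is idempotent.
  Only continuity in the left factor is available.\<close>

lemma compact_semigroup_idempotent:
  assumes "Hausdorff_space X" and S: "compactin X S" and ne: "S \<noteq> {}"
    and closed: "\<And>p q. p \<in> S \<Longrightarrow> q \<in> S \<Longrightarrow> m p q \<in> S"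
    and assoc: "\<And>p q r. p \<in> S \<Longrightarrow> q \<in> S \<Longrightarrow> r \<in> S \<Longrightarrow> m (m p q) r = m p (m q r)"
    and cont: "\<And>q. q \<in> S \<Longrightarrow> continuous_map (subtopology X S) X (\<lambda>p. m p q)"
  obtains u where "u \<in> S" "m u u = u"
proof -
  define \<F> where "\<F> = {T. closedin X T \<and> T \<noteq> {} \<and> T \<subseteq> S \<and> (\<forall>p\<in>T. \<forall>q\<in>T. m p q \<in> T)}"
  have clS: "closedin X S"
    using assms compactin_imp_closedin by blast
  have SX: "S \<subseteq> topspace X"
    using S by (rule compactin_subset_topspace)
  have "\<exists>T\<in>\<F>. \<forall>N\<in>\<F>. N \<subseteq> T \<longrightarrow> N = T"
  proof (rule minimal_closed_member[OF S, of \<F>])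
    show "\<F> \<noteq> {}"
      using clS ne closed unfolding \<F>_def by auto
    show "closedin X N" "S \<inter> N \<noteq> {}" if "N \<in> \<F>" for N
      using that by (auto simp: \<F>_def)
    show "\<Inter>\<C> \<in> \<F>" if "\<C> \<noteq> {}" "\<C> \<subseteq> \<F>" "S \<inter> \<Inter>\<C> \<noteq> {}" for \<C>
    proof -
      have "closedin X (\<Inter>\<C>)"
        using that by (intro closedin_Inter) (auto simp: \<F>_def)
      moreover have "\<Inter>\<C> \<subseteq> S"
        using that by (intro Inter_subset) (auto simp: \<F>_def)
      moreover have "m p q \<in> \<Inter>\<C>" if "p \<in> \<Inter>\<C>" "q \<in> \<Inter>\<C>" for p q
        using that \<open>\<C> \<subseteq> \<F>\<close> by (auto simp: \<F>_def)
      moreover have "\<Inter>\<C> \<noteq> {}"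
        using that(3) by auto
      ultimately show ?thesis
        unfolding \<F>_def by simp
    qed
  qed
  then obtain T where T: "T \<in> \<F>" and min: "\<And>N. N \<in> \<F> \<Longrightarrow> N \<subseteq> T \<Longrightarrow> N = T"
    by blast
  have TS: "T \<subseteq> S" and clT: "closedin X T" and neT: "T \<noteq> {}"
    and mT: "\<And>p q. p \<in> T \<Longrightarrow> q \<in> T \<Longrightarrow> m p q \<in> T"
    using T by (auto simp: \<F>_def)
  obtain u where u: "u \<in> T"
    using neT by blast
  have contu: "continuous_map (subtopology X S) X (\<lambda>p. m p u)"
    using cont u TS by blast
  have cT: "compactin (subtopology X S) T"
    using closed_compactin[OF S TS clT] TS by (simp add: compactin_subtopology)
  \<comment> \<open>The set \<open>T u\<close> is again a closed subsemigroup inside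
    \<open>T\<close>, so minimality gives \<open>T u = T\<close>.\<close>
  have "(\<lambda>p. m p u) ` T \<in> \<F>"
  proof -
    have "closedin X ((\<lambda>p. m p u) ` T)"
      using image_compactin[OF cT contu] assms(1) compactin_imp_closedin by blast
    moreover have "m (m p u) (m q u) \<in> (\<lambda>p. m p u) ` T" if "p \<in> T" "q \<in> T" for p q
    proof -
      have "m (m p u) (m q u) = m (m (m p u) q) u"
        using assoc[of "m p u" q u] that u TS mT by (simp add: subset_iff)
      then show ?thesis
        using that u mT by blast
    qed
    moreover have "(\<lambda>p. m p u) ` T \<subseteq> S"
      using mT u TS by blast
    ultimately show ?thesis
      using neT unfolding \<F>_def by simp
  qed
  moreover have "(\<lambda>p. m p u) ` T \<subseteq> T"
    using mT u by blast
  ultimately have eqT: "(\<lambda>p. m p u) ` T = T"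
    by (rule min)
  \<comment> \<open>Non-empty because \<open>u\<close> lies in \<open>T u = T\<close>. Minimality
    then gives \<open>N = T\<close>, so \<open>u\<close> itself satisfies the defining
    equation.\<close>
  define N where "N = {p \<in> T. m p u \<in> {u}}"
  have "N \<in> \<F>"
  proof -
    have "closedin X {u}"
      using u TS SX assms(1) by (intro compactin_imp_closedin) auto
    moreover have "closedin (subtopology X S) T"
      using clT TS by (simp add: closedin_closed_subtopology clS)
    ultimately have "closedin (subtopology X S) N"
      unfolding N_def using closedin_continuous_map_preimage_gen[OF contu] by blast
    then have "closedin X N"
      using clS closedin_trans_full by blast
    moreover have "N \<noteq> {}"
      using eqT u unfolding N_def by force
    moreover have "m p q \<in> N" if "p \<in> N" "q \<in> N" for p q
      using that assoc[of p q u] mT u TS unfolding N_def by (simp add: subset_iff)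
    moreover have "N \<subseteq> S"
      using TS by (auto simp: N_def)
    ultimately show ?thesis
      unfolding \<F>_def by simp
  qed
  then have "N = T"
    by (rule min) (auto simp: N_def)
  then have "u \<in> N"
    using u by simp
  then show thesis
    using that[of u] TS by (auto simp: N_def)
qed


section \<open>The enveloping space of a pointed minimal space\<close>

locale pointed_minimal_space =
  fixes G :: "('g, 'm) monoid_scheme" (structure)
    and Z :: "'z topology" and \<zeta> :: "'g \<Rightarrow> 'z \<Rightarrow> 'z" and z0 :: 'z
  assumes minimal: "minimal_lc_G_space G Z \<zeta>" and z0: "z0 \<in> topspace Z"
begin

lemma lc: "lc_G_space G Z \<zeta>" and Hausdorff: "Hausdorff_space Z" and loc_comp: "locally_compact_space Z"
  and homeo: "g \<in> carrier G \<Longrightarrow> homeomorphic_map Z Z (\<zeta> g)"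
  using minimal by (auto simp: minimal_lc_G_space_def lc_G_space_def)

sublocale group_action G "topspace Z" \<zeta>
  using lc by (simp add: lc_G_space_def)

sublocale group G
  using lc by (rule lc_G_space_imp_group)

text \<open>Equality of \<open>rel_compact_sets\<close> expresses equality of types without choosing
  a representing subset of \<open>G\<close>.\<close>

definition I :: "'z set" where
  "I = {z \<in> topspace Z. rel_compact_sets G Z \<zeta> z = rel_compact_sets G Z \<zeta> z0}"

abbreviation P :: "('z \<Rightarrow> 'z) topology" where
  "P \<equiv> product_topology (\<lambda>_. Z) I"

text \<open>\<open>compose I\<close> keeps the result extensional on \<open>I\<close>, as points of
  \<open>P\<close> must be.\<close>

abbreviation act :: "'g \<Rightarrow> ('z \<Rightarrow> 'z) \<Rightarrow> 'z \<Rightarrow> 'z" where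
  "act g \<equiv> compose I (\<zeta> g)"

definition restrictions :: "('z \<Rightarrow> 'z) set" where
  "restrictions = (\<lambda>g. restrict (\<zeta> g) I) ` carrier G"

definition E :: "('z \<Rightarrow> 'z) set" where
  "E = P closure_of restrictions"

lemma z0_in_I: "z0 \<in> I"
  using z0 by (simp add: I_def)

lemma I_subset: "z \<in> I \<Longrightarrow> z \<in> topspace Z"
  by (simp add: I_def)

lemma restrictions_subset: "restrictions \<subseteq> topspace P"
  by (auto simp: restrictions_def intro: element_image[OF _ I_subset refl])

lemma closedin_E: "closedin P E"
  by (simp add: E_def)

lemma E_subset: "E \<subseteq> topspace P"
  using closedin_E closedin_subset by blast

lemma restrictions_subset_E: "restrictions \<subseteq> E"
  unfolding E_def by (rule closure_of_subset[OF restrictions_subset])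

lemma Hausdorff_P: "Hausdorff_space P"
  using Hausdorff by (simp add: Hausdorff_space_product_topology)

lemma P_value: "p \<in> topspace P \<Longrightarrow> z \<in> I \<Longrightarrow> p z \<in> topspace Z"
  by auto

lemma continuous_eval: "z \<in> I \<Longrightarrow> continuous_map P Z (\<lambda>p. p z)"
  by (rule continuous_map_product_projection)

lemma continuous_act:
  assumes "g \<in> carrier G"
  shows "continuous_map P P (act g)"
  unfolding continuous_map_componentwise
proof (intro conjI ballI)
  fix z assume z: "z \<in> I"
  have "continuous_map P Z (\<zeta> g \<circ> (\<lambda>p. p z))"
    using continuous_eval[OF z] homeomorphic_imp_continuous_map[OF homeo[OF assms]]
    by (rule continuous_map_compose)
  then show "continuous_map P Z (\<lambda>p. act g p z)"
    using z by (simp add: compose_eq o_def)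
qed auto

text \<open>Coordinate \<open>z\<close> of the composite is coordinate \<open>q z\<close> of
  \<open>p\<close>, hence a projection. This needs \<open>q z\<close> to be in
  \<open>I\<close>.\<close>

lemma continuous_compose_right:
  assumes "q ` I \<subseteq> I"
  shows "continuous_map P P (\<lambda>p. compose I p q)"
  unfolding continuous_map_componentwise
proof (intro conjI ballI)
  fix z assume z: "z \<in> I"
  then have "q z \<in> I"
    using assms by blast
  then show "continuous_map P Z (\<lambda>p. compose I p q z)"
    using z continuous_eval by (simp add: compose_eq)
qed auto

lemma act_one:
  assumes "p \<in> topspace P"
  shows "act \<one> p = p"
proof (rule extensionalityI[of _ I])
  fix z assume "z \<in> I"
  then show "act \<one> p z = p z"
    using P_value[OF assms] id_eq_one by (metis compose_eq restrict_apply')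
qed (use assms in \<open>auto simp: PiE_def\<close>)

lemma act_mult:
  assumes "p \<in> topspace P" "g \<in> carrier G" "h \<in> carrier G"
  shows "act (g \<otimes> h) p = act g (act h p)"
  by (rule extensionalityI[of _ I])
    (use assms P_value[OF assms(1)] composition_rule in \<open>simp_all add: compose_eq\<close>)

lemma act_translation:
  assumes "g \<in> carrier G" "h \<in> carrier G"
  shows "act g (restrict (\<zeta> h) I) = restrict (\<zeta> (g \<otimes> h)) I"
  by (rule extensionalityI[of _ I])
    (use assms I_subset composition_rule in \<open>simp_all add: compose_eq\<close>)

lemma act_closure_of:
  assumes "\<And>p. p \<in> S \<Longrightarrow> act g p \<in> S" "g \<in> carrier G" "p \<in> P closure_of S"
  shows "act g p \<in> P closure_of S"
proof -
  have "act g ` (P closure_of S) \<subseteq> P closure_of (act g ` S)"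
    by (rule continuous_map_image_closure_subset[OF continuous_act[OF assms(2)]])
  also have "\<dots> \<subseteq> P closure_of S"
    using assms(1) by (intro closure_of_mono) blast
  finally show ?thesis
    using assms(3) by blast
qed

lemma act_E:
  assumes "g \<in> carrier G" "p \<in> E"
  shows "act g p \<in> E"
  unfolding E_def
proof (rule act_closure_of)
  fix p assume "p \<in> restrictions"
  then show "act g p \<in> restrictions"
    using act_translation assms(1) m_closed by (auto simp: restrictions_def)
qed (use assms in \<open>simp_all add: E_def\<close>)

text \<open>All points of \<^term>\<open>I\<close> have the same type, so the orbit piece over a compact set in one
  coordinate is relatively compact in every coordinate, and Tychonoff's theorem applies.\<close>

lemma eval_proper_on_E:
  assumes z: "z \<in> I" and K: "compactin Z K"
  shows "compactin P {p \<in> E. p z \<in> K}"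
proof -
  have "regular_space Z"
    using Hausdorff loc_comp locally_compact_Hausdorff_imp_regular_space by blast
  then obtain U L where U: "openin Z U" and L: "compactin Z L" and "K \<subseteq> U" "U \<subseteq> L"
    using K loc_comp locally_compact_space_compact_closed_compact by metis
  define B where "B = {g \<in> carrier G. \<zeta> g z \<in> U}"
  have "Z closure_of ((\<lambda>g. \<zeta> g z) ` B) \<subseteq> L"
    using \<open>U \<subseteq> L\<close> compactin_imp_closedin[OF Hausdorff L]
    by (intro closure_of_minimal) (auto simp: B_def)
  then have "compactin Z (Z closure_of ((\<lambda>g. \<zeta> g z) ` B))"
    using L by (simp add: closed_compactin)
  then have "B \<in> rel_compact_sets G Z \<zeta> z"
    by (auto simp: rel_compact_sets_def B_def)
  then have B: "compactin Z (Z closure_of ((\<lambda>g. \<zeta> g y) ` B))" if "y \<in> I" for y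
    using that z by (auto simp: I_def rel_compact_sets_def)
  define C where "C = PiE I (\<lambda>y. Z closure_of ((\<lambda>g. \<zeta> g y) ` B))"
  have C: "compactin P C"
    unfolding C_def compactin_PiE using B by blast
  have "{p \<in> E. p z \<in> K} \<subseteq> C"
  proof
    fix p assume p: "p \<in> {p \<in> E. p z \<in> K}"
    define V where "V = {p \<in> topspace P. p z \<in> U}"
    have "openin P V"
      unfolding V_def using continuous_eval[OF z] U by (rule openin_continuous_map_preimage)
    \<comment> \<open>Since \<open>V\<close> is open, a point of \<open>E\<close> in
      \<open>V\<close> is a limit of translations by elements of \<open>B\<close> alone.\<close>
    then have "V \<inter> E \<subseteq> P closure_of (V \<inter> restrictions)"
      unfolding E_def by (rule openin_Int_closure_of_subset)
    moreover have "p \<in> V \<inter> E"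
      using p E_subset \<open>K \<subseteq> U\<close> unfolding V_def by blast
    moreover have "V \<inter> restrictions \<subseteq> PiE I (\<lambda>y. (\<lambda>g. \<zeta> g y) ` B)"
      using z by (auto simp: V_def restrictions_def B_def)
    then have "P closure_of (V \<inter> restrictions) \<subseteq> C"
      unfolding C_def closure_of_product_topology[symmetric] by (rule closure_of_mono)
    ultimately show "p \<in> C"
      by blast
  qed
  moreover have "closedin P {p \<in> E. p z \<in> K}"
    using continuous_eval[OF z] closedin_E compactin_imp_closedin[OF Hausdorff K]
    by (rule closedin_continuous_map_preimage_gen)
  ultimately show ?thesis
    using C closed_compactin by blast
qed

definition invariant :: "('z \<Rightarrow> 'z) set \<Rightarrow> bool" where
  "invariant N \<longleftrightarrow> (\<forall>g\<in>carrier G. \<forall>p\<in>N. act g p \<in> N)"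

end

section \<open>Minimal closed invariant subsets of the envelope\<close>

locale minimal_in_envelope = pointed_minimal_space G Z \<zeta> z0
  for G :: "('g, 'm) monoid_scheme" (structure)
    and Z :: "'z topology" and \<zeta> :: "'g \<Rightarrow> 'z \<Rightarrow> 'z" and z0 :: 'z +
  fixes M :: "('z \<Rightarrow> 'z) set"
  assumes closedin_M: "closedin P M" and M_nonempty: "M \<noteq> {}" and M_subset_E: "M \<subseteq> E"
    and invariant_M: "invariant M"
    and minimal_M: "closedin P N \<Longrightarrow> N \<noteq> {} \<Longrightarrow> N \<subseteq> M \<Longrightarrow> invariant N \<Longrightarrow> N = M"

context pointed_minimal_space
begin

text \<open>Cocompactness of \<open>Z\<close> gives a compact \<open>K\<close> whose translates
  cover \<open>Z\<close>. The elements of \<open>E\<close> with value in \<open>K\<close> at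
  \<open>z0\<close> form a compact set, and it meets every non-empty invariant \<open>N\<close>, as
  \<open>p z0\<close> can be translated into \<open>K\<close>.\<close>

lemma minimal_in_envelope_exists:
  obtains M where "minimal_in_envelope G Z \<zeta> z0 M"
proof -
  define \<F> where "\<F> = {N. closedin P N \<and> N \<noteq> {} \<and> N \<subseteq> E \<and> invariant N}"
  obtain K where K: "compactin Z K" "(\<Union>g\<in>carrier G. \<zeta> g ` K) = topspace Z"
    using minimal_imp_cocompact[OF minimal] unfolding cocompact_action_def by blast
  have "\<exists>M\<in>\<F>. \<forall>N\<in>\<F>. N \<subseteq> M \<longrightarrow> N = M"
  proof (rule minimal_closed_member[OF eval_proper_on_E[OF z0_in_I K(1)], of \<F>])
    have "E \<noteq> {}"
      using restrictions_subset_E one_closed by (auto simp: restrictions_def)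
    then have "E \<in> \<F>"
      using closedin_E act_E by (simp add: \<F>_def invariant_def)
    then show "\<F> \<noteq> {}"
      by blast
    show "closedin P N" if "N \<in> \<F>" for N
      using that by (simp add: \<F>_def)
    show "{p \<in> E. p z0 \<in> K} \<inter> N \<noteq> {}" if N: "N \<in> \<F>" for N
    proof -
      obtain p where p: "p \<in> N" "p \<in> E"
        using N by (auto simp: \<F>_def)
      then have "p z0 \<in> topspace Z"
        using E_subset z0_in_I P_value by blast
      then obtain g k where g: "g \<in> carrier G" "k \<in> K" "p z0 = \<zeta> g k"
        using K(2) by blast
      then have "\<zeta> (inv g) (p z0) = k"
        using orbit_sym_aux[OF g(1) _ g(3)[symmetric]] compactin_subset_topspace[OF K(1)] by blast
      then have "act (inv g) p z0 \<in> K"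
        using g z0_in_I by (simp add: compose_eq)
      moreover have "act (inv g) p \<in> N"
        using N p g by (simp add: \<F>_def invariant_def)
      moreover have "N \<subseteq> E"
        using N by (simp add: \<F>_def)
      ultimately show ?thesis
        by blast
    qed
    show "\<Inter>\<C> \<in> \<F>" if "\<C> \<noteq> {}" "\<C> \<subseteq> \<F>" "{p \<in> E. p z0 \<in> K} \<inter> \<Inter>\<C> \<noteq> {}" for \<C>
    proof -
      have "closedin P (\<Inter>\<C>)"
        using that by (intro closedin_Inter) (auto simp: \<F>_def)
      moreover have "\<Inter>\<C> \<subseteq> E"
        using that by (intro Inter_subset) (auto simp: \<F>_def)
      moreover have "invariant (\<Inter>\<C>)"
        using \<open>\<C> \<subseteq> \<F>\<close> by (auto simp: \<F>_def invariant_def)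
      moreover have "\<Inter>\<C> \<noteq> {}"
        using that(3) by auto
      ultimately show ?thesis
        unfolding \<F>_def by simp
    qed
  qed
  then obtain M where M: "M \<in> \<F>" and min: "\<And>N. N \<in> \<F> \<Longrightarrow> N \<subseteq> M \<Longrightarrow> N = M"
    by blast
  have "minimal_in_envelope G Z \<zeta> z0 M"
  proof unfold_locales
    fix N assume "closedin P N" "N \<noteq> {}" "N \<subseteq> M" "invariant N"
    then show "N = M"
      using M by (intro min) (auto simp: \<F>_def)
  qed (use M in \<open>auto simp: \<F>_def\<close>)
  then show thesis
    by (rule that)
qed

end


section \<open>Endomorphisms of a minimal set\<close>

context minimal_in_envelope
begin

section \<open>The minimal set as a minimal \<open>G\<close>-space\<close>

definition X :: "('z \<Rightarrow> 'z) topology" where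
  "X = subtopology P M"

abbreviation \<psi> :: "'g \<Rightarrow> ('z \<Rightarrow> 'z) \<Rightarrow> 'z \<Rightarrow> 'z" where
  "\<psi> g \<equiv> restrict (act g) M"

lemma M_subset: "M \<subseteq> topspace P"
  using M_subset_E E_subset by blast

lemma topspace_X: "topspace X = M"
  unfolding X_def using M_subset by (rule topspace_subtopology_subset)

lemma compactin_X: "compactin X S \<longleftrightarrow> compactin P S \<and> S \<subseteq> M"
  by (simp add: X_def compactin_subtopology)

lemma Hausdorff_X: "Hausdorff_space X"
  unfolding X_def using Hausdorff_P by (rule Hausdorff_space_subtopology)

lemma continuous_from_X: "continuous_map P Y f \<Longrightarrow> continuous_map X Y f"
  unfolding X_def by (rule continuous_map_from_subtopology)

lemma continuous_into_X: "continuous_map Y X f \<longleftrightarrow> continuous_map Y P f \<and> f \<in> topspace Y \<rightarrow> M"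
  unfolding X_def by (rule continuous_map_in_subtopology)

lemma act_M: "g \<in> carrier G \<Longrightarrow> p \<in> M \<Longrightarrow> act g p \<in> M"
  using invariant_M by (simp add: invariant_def)

lemma M_value: "p \<in> M \<Longrightarrow> z \<in> I \<Longrightarrow> p z \<in> topspace Z"
  using M_subset P_value by blast

lemma eval_proper_on_M:
  assumes "z \<in> I" "compactin Z K"
  shows "compactin P {p \<in> M. p z \<in> K}"
proof -
  have "{p \<in> M. p z \<in> K} = M \<inter> {p \<in> E. p z \<in> K}"
    using M_subset_E by blast
  then show ?thesis
    using closedin_M eval_proper_on_E[OF assms] by (simp add: closed_Int_compactin)
qed

text \<open>Local compactness is pulled back from \<open>Z\<close> along evaluation at
  \<open>z0\<close>, which is proper on \<open>M\<close>.\<close>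

lemma lc_G_space_X: "lc_G_space G X \<psi>"
proof (rule lc_G_spaceI)
  show "Hausdorff_space X"
    by (rule Hausdorff_X)
  show "locally_compact_space X"
    unfolding locally_compact_space_def
  proof
    fix p assume "p \<in> topspace X"
    then have p: "p \<in> M"
      by (simp add: topspace_X)
    obtain U K where U: "openin Z U" "p z0 \<in> U" and K: "compactin Z K" "U \<subseteq> K"
      using loc_comp M_value[OF p z0_in_I] unfolding locally_compact_space_def by metis
    have "openin X {p \<in> topspace X. p z0 \<in> U}"
      using continuous_from_X[OF continuous_eval[OF z0_in_I]] U(1)
      by (rule openin_continuous_map_preimage)
    moreover have "compactin X {p \<in> M. p z0 \<in> K}"
      using eval_proper_on_M[OF z0_in_I K(1)] by (auto simp: compactin_X)
    moreover have "p \<in> {p \<in> topspace X. p z0 \<in> U}" "{p \<in> topspace X. p z0 \<in> U} \<subseteq> {p \<in> M. p z0 \<in> K}"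
      using p U K by (auto simp: topspace_X)
    ultimately show "\<exists>U K. openin X U \<and> compactin X K \<and> p \<in> U \<and> U \<subseteq> K"
      by blast
  qed
next
  fix g assume g: "g \<in> carrier G"
  show "\<psi> g \<in> extensional (topspace X)"
    by (simp add: topspace_X)
  have "continuous_map X X (act g)"
    using continuous_from_X[OF continuous_act[OF g]] act_M[OF g]
    by (simp add: continuous_into_X topspace_X)
  then show "continuous_map X X (\<psi> g)"
    by (rule continuous_map_eq) (simp add: topspace_X)
next
  fix p assume "p \<in> topspace X"
  then have p: "p \<in> M" "p \<in> topspace P"
    using topspace_X M_subset by auto
  then show "\<psi> \<one> p = p"
    using act_one by simp
  show "\<psi> (g \<otimes> h) p = \<psi> g (\<psi> h p)" if "g \<in> carrier G" "h \<in> carrier G" for g h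
    using that p by (simp add: act_mult act_M)
qed (rule is_group)

text \<open>The closure of an orbit is a closed invariant subset of \<open>M\<close>, so it is
  \<open>M\<close>.\<close>

lemma minimal_X: "minimal_lc_G_space G X \<psi>"
  unfolding minimal_lc_G_space_def topspace_X
proof (intro conjI ballI)
  fix p assume p: "p \<in> M"
  let ?S = "(\<lambda>g. act g p) ` carrier G"
  have orb: "orbit G \<psi> p = ?S"
    using p by (auto simp: orbit_def)
  have S: "?S \<subseteq> M"
    using p act_M by blast
  have "P closure_of ?S = M"
  proof (rule minimal_M)
    show "P closure_of ?S \<noteq> {}"
      using closure_of_subset[of ?S P] S M_subset one_closed by blast
    show "P closure_of ?S \<subseteq> M"
      using S closedin_M by (rule closure_of_minimal)
    have "act g q \<in> ?S" if "g \<in> carrier G" "q \<in> ?S" for g q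
      using that p M_subset act_mult[symmetric] m_closed by fastforce
    then show "invariant (P closure_of ?S)"
      unfolding invariant_def using act_closure_of by blast
  qed simp
  then show "X closure_of orbit G \<psi> p = M"
    using S orb by (simp add: X_def closure_of_subtopology Int_absorb1)
qed (simp_all add: lc_G_space_X M_nonempty)

lemma eval_G_map:
  assumes z: "z \<in> I"
  shows "proper_surjective_G_map G X \<psi> Z \<zeta> (\<lambda>p. p z)"
proof (rule proper_surjective_G_mapI)
  show "continuous_map X Z (\<lambda>p. p z)"
    using continuous_eval[OF z] by (rule continuous_from_X)
  show "compactin X {p \<in> topspace X. p z \<in> K}" if "compactin Z K" for K
    using eval_proper_on_M[OF z that] by (auto simp: topspace_X compactin_X)
  show "G_equivariant G X \<psi> \<zeta> (\<lambda>p. p z)"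
    unfolding G_equivariant_def topspace_X using z by (simp add: compose_eq)
  show "\<psi> g p \<in> topspace X" if "g \<in> carrier G" "p \<in> topspace X" for g p
    using that act_M unfolding topspace_X by simp
qed (use M_nonempty topspace_X minimal in simp_all)

section \<open>Right composition with type-preserving elements\<close>

definition J :: "('z \<Rightarrow> 'z) set" where
  "J = {p \<in> M. p ` I \<subseteq> I}"

lemma rel_compact_sets_eval:
  assumes "p \<in> M" "z \<in> I"
  shows "rel_compact_sets G Z \<zeta> (p z) = rel_compact_sets G X \<psi> p"
  using proper_surjective_G_map_rel_compact_sets[OF eval_G_map lc_G_space_X lc] assms
  by (simp add: topspace_X)

text \<open>By properness of evaluations, all values of \<open>p\<close> on \<open>I\<close> have
  the type of \<open>p\<close> in \<open>X\<close>. Hence \<open>J\<close> depends only on the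
  \<open>G\<close>-space \<open>X\<close> and the type of \<open>z0\<close>, and is preserved by
  proper endomorphisms.\<close>

lemma J_iff:
  assumes "p \<in> M"
  shows "p \<in> J \<longleftrightarrow> rel_compact_sets G X \<psi> p = rel_compact_sets G Z \<zeta> z0"
proof -
  have "p z \<in> I \<longleftrightarrow> rel_compact_sets G X \<psi> p = rel_compact_sets G Z \<zeta> z0" if "z \<in> I" for z
    using rel_compact_sets_eval[OF assms that] M_value[OF assms that] by (simp add: I_def)
  then show ?thesis
    using assms z0_in_I by (auto simp: J_def)
qed

text \<open>The value at a single point already determines the type of \<open>p\<close>.\<close>

lemma J_I: "p \<in> M \<Longrightarrow> z \<in> I \<Longrightarrow> p z \<in> I \<Longrightarrow> p \<in> J"
  using J_iff[of p] rel_compact_sets_eval[of p z] by (simp add: I_def)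

text \<open>Evaluation at \<open>z0\<close> is onto, so some element of \<open>M\<close> fixes
  \<open>z0\<close>.\<close>

lemma J_nonempty: "J \<noteq> {}"
proof -
  have "(\<lambda>p. p z0) ` M = topspace Z"
    using eval_G_map[OF z0_in_I] by (simp add: proper_surjective_G_map_def topspace_X)
  then obtain p where "p \<in> M" "p z0 = z0"
    using z0 by (metis imageE)
  then show ?thesis
    using J_I[of p z0] z0_in_I by auto
qed

lemma endomorphism_J:
  assumes k: "proper_surjective_G_map G X \<psi> X \<psi> k" and q: "q \<in> J"
  shows "k q \<in> J"
proof -
  have qM: "q \<in> M"
    using q by (simp add: J_def)
  moreover have "k q \<in> M"
    using k qM unfolding proper_surjective_G_map_def topspace_X by blast
  moreover have "rel_compact_sets G X \<psi> (k q) = rel_compact_sets G X \<psi> q"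
    using proper_surjective_G_map_rel_compact_sets[OF k lc_G_space_X lc_G_space_X] qM
    by (simp add: topspace_X)
  ultimately show ?thesis
    using q J_iff by simp
qed

text \<open>If \<open>p\<close> is a translation, the composite is \<open>act g q\<close>, in
  \<open>M\<close> by invariance. Continuity in \<open>p\<close> and closedness of \<open>M\<close>
  extend this to the closure \<open>E\<close>.\<close>

lemma compose_E:
  assumes q: "q \<in> J" and p: "p \<in> E"
  shows "compose I p q \<in> M"
proof -
  have qI: "q ` I \<subseteq> I" and qM: "q \<in> M"
    using q by (auto simp: J_def)
  have "compose I (restrict (\<zeta> g) I) q = act g q" for g
    using qI by (intro extensionalityI[of _ I]) (auto simp: compose_eq)
  then have "(\<lambda>p. compose I p q) ` restrictions \<subseteq> M"
    using act_M qM by (auto simp: restrictions_def)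
  then have "P closure_of ((\<lambda>p. compose I p q) ` restrictions) \<subseteq> M"
    using closedin_M by (rule closure_of_minimal)
  then show ?thesis
    using continuous_map_image_closure_subset[OF continuous_compose_right[OF qI]] p
    unfolding E_def by blast
qed

lemma compose_M: "p \<in> M \<Longrightarrow> q \<in> J \<Longrightarrow> compose I p q \<in> M"
  by (rule compose_E[OF _ subsetD[OF M_subset_E]])

lemma compose_assoc_J: "q \<in> J \<Longrightarrow> compose I (compose I p r) q = compose I p (compose I r q)"
  by (rule compose_assoc[where B = I, symmetric]) (simp add: J_def image_subset_iff_funcset)

lemma compose_G_map:
  assumes q: "q \<in> J"
  shows "proper_surjective_G_map G X \<psi> X \<psi> (\<lambda>p. compose I p q)"
proof (rule proper_surjective_G_mapI)
  have qI: "q ` I \<subseteq> I"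
    using q by (simp add: J_def)
  show "topspace X \<noteq> {}"
    using M_nonempty by (simp add: topspace_X)
  show "minimal_lc_G_space G X \<psi>"
    by (rule minimal_X)
  show cont: "continuous_map X X (\<lambda>p. compose I p q)"
    using continuous_from_X[OF continuous_compose_right[OF qI]] compose_M[OF _ q]
    by (simp add: continuous_into_X topspace_X)
  show "compactin X {p \<in> topspace X. compose I p q \<in> K}" if K: "compactin X K" for K
  proof -
    \<comment> \<open>If \<open>compose I p q\<close> lies in \<open>K\<close>, then
      \<open>p (q z0)\<close> lies in this compact set. Properness of evaluation at
      \<open>q z0\<close> then bounds the preimage of \<open>K\<close>.\<close>
    have "compactin Z ((\<lambda>p. p z0) ` K)"
      using K continuous_from_X[OF continuous_eval[OF z0_in_I]] by (rule image_compactin)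
    moreover have "q z0 \<in> I"
      using qI z0_in_I by blast
    ultimately have "compactin X {p \<in> M. p (q z0) \<in> (\<lambda>p. p z0) ` K}"
      using eval_proper_on_M by (auto simp: compactin_X)
    moreover have "{p \<in> topspace X. compose I p q \<in> K} \<subseteq> {p \<in> M. p (q z0) \<in> (\<lambda>p. p z0) ` K}"
    proof
      fix p assume "p \<in> {p \<in> topspace X. compose I p q \<in> K}"
      then have "p \<in> M" "compose I p q z0 \<in> (\<lambda>p. p z0) ` K"
        by (auto simp: topspace_X)
      then show "p \<in> {p \<in> M. p (q z0) \<in> (\<lambda>p. p z0) ` K}"
        using z0_in_I by (simp add: compose_eq)
    qed
    moreover have "closedin X {p \<in> topspace X. compose I p q \<in> K}"
      using cont compactin_imp_closedin[OF Hausdorff_X K]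
      by (rule closedin_continuous_map_preimage)
    ultimately show ?thesis
      by (rule closed_compactin)
  qed
  show "G_equivariant G X \<psi> \<psi> (\<lambda>p. compose I p q)"
    unfolding G_equivariant_def topspace_X
  proof (intro ballI)
    fix g p assume p: "p \<in> M"
    have "compose I (act g p) q = act g (compose I p q)"
      by (rule compose_assoc_J[OF q])
    then show "compose I (\<psi> g p) q = \<psi> g (compose I p q)"
      using p compose_M[OF p q] by simp
  qed
  show "\<psi> g p \<in> topspace X" if "g \<in> carrier G" "p \<in> topspace X" for g p
    using that act_M unfolding topspace_X by simp
qed

lemma compose_surj:
  assumes "q \<in> J" "r \<in> M"
  obtains p where "p \<in> M" "compose I p q = r"
proof -
  have "(\<lambda>p. compose I p q) ` M = M"
    using compose_G_map[OF assms(1)] by (simp add: proper_surjective_G_map_def topspace_X)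
  then have "r \<in> (\<lambda>p. compose I p q) ` M"
    using assms(2) by simp
  then show thesis
    using that by blast
qed

section \<open>A right identity and the invertibility of endomorphisms\<close>

lemma right_identity_exists:
  obtains u where "u \<in> J" "\<And>p. p \<in> M \<Longrightarrow> compose I p u = p"
proof -
  obtain m where m: "m \<in> J"
    using J_nonempty by blast
  then have mM: "m \<in> M" and mI: "m ` I \<subseteq> I"
    by (auto simp: J_def)
  \<comment> \<open>The fibre over \<open>m\<close> of a proper surjective map
    \<open>M \<rightarrow> M\<close>, hence compact and non-empty. Each of its elements fixes the
    point \<open>m z0\<close> of \<open>I\<close> and so belongs to \<open>J\<close>.\<close>
  define S where "S = {p \<in> M. compose I p m \<in> {m}}"
  have SJ: "S \<subseteq> J"
  proof
    fix p assume p: "p \<in> S"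
    have m0: "m z0 \<in> I"
      using mI z0_in_I by blast
    have "compose I p m z0 = m z0"
      using p by (simp add: S_def)
    then have "p (m z0) = m z0"
      using z0_in_I by (simp add: compose_eq)
    then show "p \<in> J"
      using p J_I[of p "m z0"] m0 by (simp add: S_def)
  qed
  have "compactin X {m}"
    using mM by (simp add: topspace_X)
  then have compact: "compactin X S"
    using compose_G_map[OF m] unfolding proper_surjective_G_map_def topspace_X S_def by blast
  have nonempty: "S \<noteq> {}"
    using compose_surj[OF m mM] unfolding S_def by blast
  have closed: "compose I p q \<in> S" if "p \<in> S" "q \<in> S" for p q
  proof -
    have "compose I (compose I p q) m = m"
      using that unfolding compose_assoc_J[OF m] S_def by simp
    then show ?thesis
      using that compose_M SJ by (auto simp: S_def)
  qed
  have assoc: "compose I (compose I p q) r = compose I p (compose I q r)"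
    if "p \<in> S" "q \<in> S" "r \<in> S" for p q r
    using that SJ compose_assoc_J by blast
  have cont: "continuous_map (subtopology X S) X (\<lambda>p. compose I p q)" if "q \<in> S" for q
    using that SJ compose_G_map unfolding proper_surjective_G_map_def
    by (blast intro: continuous_map_from_subtopology)
  obtain u where u: "u \<in> S" "compose I u u = u"
    by (rule compact_semigroup_idempotent[where m = "compose I",
          OF Hausdorff_X compact nonempty closed assoc cont])
  have uJ: "u \<in> J"
    using u SJ by blast
  \<comment> \<open>Right composition with \<open>u\<close> is onto, so \<open>p = r u\<close> for
    some \<open>r\<close>, and \<open>p u = r u u = r u = p\<close>.\<close>
  have "compose I p u = p" if p: "p \<in> M" for p
  proof -
    obtain r where "compose I r u = p"
      using compose_surj[OF uJ p] by blast
    then show ?thesis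
      using compose_assoc_J[OF uJ, of r u] u by simp
  qed
  then show thesis
    using that uJ by blast
qed

text \<open>With \<open>w = k u\<close>, equivariance makes \<open>k\<close> equal to right
  composition with \<open>w\<close>. Some \<open>v\<close> in \<open>J\<close> satisfies
  \<open>v w = u\<close>, so \<open>k (p v) = p v w = p u = p\<close>. As right composition with
  \<open>v\<close> is onto, \<open>k\<close> is injective.\<close>

lemma endomorphism_inj:
  assumes k: "proper_surjective_G_map G X \<psi> X \<psi> k"
  shows "inj_on k M"
proof -
  obtain u where u: "u \<in> J" and id: "\<And>p. p \<in> M \<Longrightarrow> compose I p u = p"
    using right_identity_exists by blast
  define w where "w = k u"
  have w: "w \<in> J"
    unfolding w_def using k u by (rule endomorphism_J)
  have uM: "u \<in> M"
    using u by (simp add: J_def)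
  have translate: "compose I (restrict (\<zeta> g) I) q = \<psi> g q" if "q \<in> J" for g q
    using that by (intro extensionalityI[of _ I]) (auto simp: J_def compose_eq)
  \<comment> \<open>The identity is proved on \<open>E\<close>, where translations are dense; they
    need not lie in \<open>M\<close>. For a translation it is equivariance of \<open>k\<close> at
    \<open>u\<close>.\<close>
  have k_eq: "k (compose I p u) = compose I p w" if p: "p \<in> E" for p
  proof (rule forall_in_closure_of_eq[where X = "subtopology P E" and Y = P and S = restrictions
        and f = "\<lambda>p. k (compose I p u)" and g = "\<lambda>p. compose I p w"])
    show "p \<in> subtopology P E closure_of restrictions"
      using p restrictions_subset_E by (simp add: closure_of_subtopology Int_absorb1 E_def)
    show "Hausdorff_space P"
      by (rule Hausdorff_P)
    have uI: "u ` I \<subseteq> I" and wI: "w ` I \<subseteq> I"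
      using u w by (auto simp: J_def)
    have "continuous_map (subtopology P E) X (\<lambda>p. compose I p u)"
      using continuous_map_from_subtopology[OF continuous_compose_right[OF uI]] compose_E[OF u]
      by (auto simp: continuous_into_X)
    moreover have "continuous_map X P k"
      using k unfolding proper_surjective_G_map_def continuous_into_X by blast
    ultimately have "continuous_map (subtopology P E) P (k \<circ> (\<lambda>p. compose I p u))"
      by (rule continuous_map_compose)
    then show "continuous_map (subtopology P E) P (\<lambda>p. k (compose I p u))"
      by (simp add: o_def)
    show "continuous_map (subtopology P E) P (\<lambda>p. compose I p w)"
      using continuous_compose_right[OF wI] by (rule continuous_map_from_subtopology)
    fix q assume "q \<in> restrictions"
    then obtain g where g: "g \<in> carrier G" "q = restrict (\<zeta> g) I"
      by (auto simp: restrictions_def)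
    then show "k (compose I q u) = compose I q w"
      using k translate[OF u] translate[OF w] uM
      unfolding proper_surjective_G_map_def G_equivariant_def topspace_X w_def by simp
  qed
  obtain v where v: "v \<in> M" "compose I v w = u"
    using compose_surj[OF w uM] by blast
  \<comment> \<open>The element \<open>v\<close> sends the point \<open>w z0\<close> of
    \<open>I\<close> to \<open>u z0\<close>, again in \<open>I\<close>, and one such value
    suffices.\<close>
  have "v \<in> J"
  proof (rule J_I[OF v(1)])
    show "w z0 \<in> I"
      using w z0_in_I by (auto simp: J_def)
    have "v (w z0) = u z0"
      using v(2) z0_in_I by (metis compose_eq)
    then show "v (w z0) \<in> I"
      using u z0_in_I by (auto simp: J_def)
  qed
  have inverse: "k (compose I p v) = p" if "p \<in> M" for p
  proof -
    have "compose I p v \<in> M"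
      using that \<open>v \<in> J\<close> by (rule compose_M)
    then have "k (compose I p v) = compose I (compose I p v) w"
      using k_eq[of "compose I p v"] id M_subset_E by auto
    also have "\<dots> = p"
      unfolding compose_assoc_J[OF w] v(2) using that by (rule id)
    finally show ?thesis .
  qed
  show ?thesis
  proof (rule inj_onI)
    fix p q assume "p \<in> M" "q \<in> M" and eq: "k p = k q"
    then obtain p' q' where "p' \<in> M" "compose I p' v = p" "q' \<in> M" "compose I q' v = q"
      using compose_surj[OF \<open>v \<in> J\<close>] by metis
    then show "p = q"
      using inverse eq by metis
  qed
qed

end


section \<open>Uniqueness\<close>

theorem theorem6p7:
  fixes G :: "('g, 'm) monoid_scheme" (structure)
    and A :: "'g set"
    and Z1 :: "'z1 topology" and \<zeta>1 :: "'g \<Rightarrow> 'z1 \<Rightarrow> 'z1"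
    and Z2 :: "'z2 topology" and \<zeta>2 :: "'g \<Rightarrow> 'z2 \<Rightarrow> 'z2"
  assumes "group G"
    and "A \<subseteq> carrier G"
    and "minimal_type G A"
    and "universal_minimal_G_space G A Z1 \<zeta>1"
    and "universal_minimal_G_space G A Z2 \<zeta>2"
  shows "isomorphic_G_spaces G Z1 \<zeta>1 Z2 \<zeta>2"
proof -
  obtain X :: "'g set set topology" and \<phi> x0
    where X: "minimal_lc_G_space G X \<phi>" "pointed_lc_G_space G X \<phi> x0"
      "G_type G X \<phi> x0 = translate_class G A"
    using \<open>minimal_type G A\<close> unfolding minimal_type_def by blast
  obtain f1 where f1: "proper_surjective_G_map G Z1 \<zeta>1 X \<phi> f1"
    using assms(4) X unfolding universal_minimal_G_space_def by blast
  obtain f2 where f2: "proper_surjective_G_map G Z2 \<zeta>2 X \<phi> f2"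
    using assms(5) X unfolding universal_minimal_G_space_def by blast
  have min1: "minimal_lc_G_space G Z1 \<zeta>1" and min2: "minimal_lc_G_space G Z2 \<zeta>2"
    using assms by (auto simp: universal_minimal_G_space_def)
  have x0: "x0 \<in> topspace X"
    using X(2) by (simp add: pointed_lc_G_space_def)
  \<comment> \<open>Proper maps preserve types, so any preimage of \<open>x0\<close> is a point of
    type \<open>A\<close>. This turns \<open>Z1\<close>, and likewise \<open>Z2\<close>, into a test
    space for universality.\<close>
  obtain z1 where z1: "z1 \<in> topspace Z1" "G_type G Z1 \<zeta>1 z1 = translate_class G A"
    using G_type_lift[OF f1 min1 X(1) x0] X(3) by metis
  obtain z2 where z2: "z2 \<in> topspace Z2" "G_type G Z2 \<zeta>2 z2 = translate_class G A"
    using G_type_lift[OF f2 min2 X(1) x0] X(3) by metis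
  obtain f where f: "proper_surjective_G_map G Z1 \<zeta>1 Z2 \<zeta>2 f"
    using universal_minimal_G_spaceD[OF assms(4) min2 minimal_pointed[OF min2 z2(1)] z2(2)] by blast
  interpret E: pointed_minimal_space G Z1 \<zeta>1 z1
    using min1 z1 by unfold_locales
  obtain M where "minimal_in_envelope G Z1 \<zeta>1 z1 M"
    using E.minimal_in_envelope_exists by blast
  then interpret M: minimal_in_envelope G Z1 \<zeta>1 z1 M .
  obtain m where m: "m \<in> M.J"
    using M.J_nonempty by blast
  then have mM: "m \<in> M"
    by (simp add: M.J_def)
  \<comment> \<open>Elements of \<open>J\<close> have the type of \<open>z1\<close>. Pointed at
    \<open>m\<close>, the minimal set is thus a test space for \<open>Z2\<close>, which closes the
    circle of maps.\<close>
  have "G_type G M.X M.\<psi> m = translate_class G A"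
    using m M.J_iff[OF mM] z1(2) by (simp add: G_type_def)
  moreover have "m \<in> topspace M.X"
    using mM M.topspace_X by simp
  ultimately obtain k where k: "proper_surjective_G_map G Z2 \<zeta>2 M.X M.\<psi> k"
    using universal_minimal_G_spaceD[OF assms(5) M.minimal_X minimal_pointed[OF M.minimal_X]] by blast
  have "inj_on (k \<circ> (f \<circ> (\<lambda>p. p z1))) M"
    by (intro M.endomorphism_inj proper_surjective_G_map_compose[OF _ k]
        proper_surjective_G_map_compose[OF _ f] M.eval_G_map E.z0_in_I)
  moreover have "(\<lambda>p. p z1) ` M = topspace Z1"
    using M.eval_G_map[OF E.z0_in_I] by (simp add: proper_surjective_G_map_def M.topspace_X)
  \<comment> \<open>Evaluation at \<open>z1\<close> maps \<open>M\<close> onto \<open>Z1\<close>, so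
    injectivity of the composite passes to \<open>k \<circ> f\<close> on all of \<open>Z1\<close>,
    and from there to \<open>f\<close>.\<close>
  ultimately have "inj_on f (topspace Z1)"
    by (metis inj_on_imageI inj_on_imageI2)
  then have "homeomorphic_map Z1 Z2 f"
    using f min2 by (intro proper_surjective_G_map_homeomorphic) (auto simp: minimal_lc_G_space_def)
  then show ?thesis
    using f unfolding isomorphic_G_spaces_def proper_surjective_G_map_def by blast
qed

end
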